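(* Let $G$ and $H$ be finite graphs with $\chi_{v}(G) = \chi_{v}(H)$. Then $\rk(G \times H) = \rk(G) + \rk(H)$ if and only if every optimal vector coloring of $G \times H$ is a convex combination of vector colorings induced by $G$ and $H$.
   Context: For real $t \ge 1$, a vector $t$-coloring of a graph $G$ is an assignment $i \mapsto p_i$ of real vectors with $p_i^Tp_i = t-1$ for all vertices $i$ and $p_i^Tp_j \le -1$ whenever $i \sim j$. The vector chromatic number $\chi_{v}(G)$ is the least such $t$; vector $\chi_v(G)$-colorings are optimal. Vector colorings are identified when they have the same Gram matrix. The rank of a vector coloring is the dimension of the span of its vectors, and $\rk(G)$ is the maximum rank of an optimal vector coloring of $G$. The categorical product $G\times H$ has vertex set $V(G)\times V(H)$ with $(i,\ell)\sim(j,k)$ iff $i\sim j$ and $\ell\sim k$. A vector coloring of $G\times H$ is a convex combination of vector colorings induced by $G$ and $H$ if its Gram matrix equals $\alpha (M \otimes J) + \beta (J \otimes N)$, where $M$, $N$ are Gram matrices of optimal vector colorings of $G$ and $H$ respectively, $J$ denotes all-ones matrices of the appropriate size, and $\alpha,\beta \ge 0$ with $\alpha+\beta=1$. *)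

theory Defs
  imports "Graph_Theory.Pair_Digraph" "Jordan_Normal_Form.DL_Rank"
begin

text \<open>Finite simple graphs are rendered by \<^locale>\<open>pair_graph\<close>: the set
  \<^term>\<open>parcs G\<close> contains both orientations of every edge.\<close>

definition categorical_product ::
    "'a pair_pre_digraph \<Rightarrow> 'b pair_pre_digraph \<Rightarrow> ('a \<times> 'b) pair_pre_digraph" where
  "categorical_product G H =
     \<lparr> pverts = pverts G \<times> pverts H,
       parcs = {((i, l), (j, k)) | i l j k. (i, j) \<in> parcs G \<and> (l, k) \<in> parcs H} \<rparr>"

text \<open>The ambient dimension \<^term>\<open>d\<close> of a vector coloring is arbitrary: every definition
  and statement below that speaks of colorings quantifies over it.\<close>

definition vector_coloring ::
    "'a pair_pre_digraph \<Rightarrow> real \<Rightarrow> nat \<Rightarrow> ('a \<Rightarrow> real vec) \<Rightarrow> bool" where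
  "vector_coloring G t d p \<longleftrightarrow>
     1 \<le> t \<and>
     (\<forall>i\<in>pverts G. p i \<in> carrier_vec d \<and> scalar_prod (p i) (p i) = t - 1) \<and>
     (\<forall>i j. (i, j) \<in> parcs G \<longrightarrow> scalar_prod (p i) (p j) \<le> -1)"

definition vector_chromatic_number :: "'a pair_pre_digraph \<Rightarrow> real" where
  "vector_chromatic_number G = (LEAST t. \<exists>d p. vector_coloring G t d p)"

definition optimal_vector_coloring ::
    "'a pair_pre_digraph \<Rightarrow> nat \<Rightarrow> ('a \<Rightarrow> real vec) \<Rightarrow> bool" where
  "optimal_vector_coloring G d p \<longleftrightarrow> vector_coloring G (vector_chromatic_number G) d p"

definition (in vec_space) span_dim :: "'a vec set \<Rightarrow> nat" where
  "span_dim S = vectorspace.dim class_ring (span_vs S)"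

definition coloring_rank :: "'a pair_pre_digraph \<Rightarrow> nat \<Rightarrow> ('a \<Rightarrow> real vec) \<Rightarrow> nat" where
  "coloring_rank G d p = vec_space.span_dim d (p ` pverts G)"

definition max_rank :: "'a pair_pre_digraph \<Rightarrow> nat" where
  "max_rank G = Max {coloring_rank G d p | d p. optimal_vector_coloring G d p}"

text \<open>Matrices indexed by vertices are functions of two vertices; only their entries at
  vertices of the graph at hand are meaningful.\<close>

definition gram :: "('a \<Rightarrow> real vec) \<Rightarrow> 'a \<Rightarrow> 'a \<Rightarrow> real" where
  "gram p i j = scalar_prod (p i) (p j)"

definition all_ones :: "'a \<Rightarrow> 'a \<Rightarrow> real" where
  "all_ones i j = 1"

definition kronecker ::
    "('a \<Rightarrow> 'a \<Rightarrow> real) \<Rightarrow> ('b \<Rightarrow> 'b \<Rightarrow> real) \<Rightarrow> 'a \<times> 'b \<Rightarrow> 'a \<times> 'b \<Rightarrow> real" where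
  "kronecker A B x y = A (fst x) (fst y) * B (snd x) (snd y)"

definition convex_combination_of_induced ::
    "'a pair_pre_digraph \<Rightarrow> 'b pair_pre_digraph \<Rightarrow> ('a \<times> 'b \<Rightarrow> real vec) \<Rightarrow> bool" where
  "convex_combination_of_induced G H p \<longleftrightarrow>
     (\<exists>d q e r \<alpha> \<beta>.
        optimal_vector_coloring G d q \<and> optimal_vector_coloring H e r \<and>
        0 \<le> \<alpha> \<and> 0 \<le> \<beta> \<and> \<alpha> + \<beta> = 1 \<and>
        (\<forall>x \<in> pverts (categorical_product G H). \<forall>y \<in> pverts (categorical_product G H).
           gram p x y = \<alpha> * kronecker (gram q) all_ones x y + \<beta> * kronecker all_ones (gram r) x y))"

end

theory Submission
  imports Defs "HOL-Analysis.Function_Topology"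
begin

text \<open>Strong duality gives for each factor a psd matrix B, nonnegative and supported on the
  diagonal and the edges, with trace 1 and entry sum t; complementary slackness makes its diagonal a
  weight vector annihilated by every optimal Gram matrix. Certificates of the factors combine
  to a certificate of the product, so the product also has vector chromatic number t. If M and N
  have maximal rank, then the Gram matrix of (M \<otimes> J + J \<otimes> N) / 2 has rank
  rk G + rk H, the diagonal weights keeping the two column spaces independent. When this is the
  maximum, every optimal Gram matrix P vanishes on its kernel, which forces p(i, l) = a(i) + b(l);
  centring a and b with the weights makes the cross terms vanish, and averaging the edge
  inequalities against the certificates shows that a and b are rescaled optimal colorings.\<close>

section \<open>Positive semidefinite matrices indexed by a finite set\<close>

text \<open>The mean of an optimal Gram matrix P of the product and a reference matrix X of maximal
  rank is again optimal, so its rank is at most that of X. For psd matrices the kernel of a mean is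
  the intersection of the kernels, whence ker X is contained in ker P. A vector whose two marginals
  lie in the kernels of M and N lies in ker X, so a few explicit test vectors split P. The column
  spaces of M \<otimes> J and J \<otimes> N can only share the all-ones direction, and they do so
  exactly when the all-ones vector lies in the column spaces of both M and N. A kernel vector of M
  with nonzero sum excludes this. The diagonal of B is one: every column of B is annihilated by the
  optimal Gram matrices, and slackness shows that the sum of the columns is t times the diagonal.
  Linear algebra is phrased through kernel vectors supported on sets of vertices, which avoids both
  ambient dimensions and orderings of the vertices. The value t = 1 is treated apart, since
  rescaling divides by t - 1 and certificates for t are limits of certificates for s with 1 \<le> s
  < t.\<close>

definition quad_form :: "'a set \<Rightarrow> ('a \<Rightarrow> 'a \<Rightarrow> real) \<Rightarrow> ('a \<Rightarrow> real) \<Rightarrow> real" where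
  "quad_form V X f = (\<Sum>i\<in>V. \<Sum>j\<in>V. f i * f j * X i j)"

definition psd :: "'a set \<Rightarrow> ('a \<Rightarrow> 'a \<Rightarrow> real) \<Rightarrow> bool" where
  "psd V X \<longleftrightarrow> (\<forall>i\<in>V. \<forall>j\<in>V. X i j = X j i) \<and> (\<forall>f. 0 \<le> quad_form V X f)"

lemma psd_sym: "psd V X \<Longrightarrow> i \<in> V \<Longrightarrow> j \<in> V \<Longrightarrow> X i j = X j i"
  and psd_quad: "psd V X \<Longrightarrow> 0 \<le> quad_form V X f"
  by (auto simp: psd_def)

lemma quad_form_cong:
  assumes "\<And>i j. i \<in> V \<Longrightarrow> j \<in> V \<Longrightarrow> X i j = Y i j" and "\<And>i. i \<in> V \<Longrightarrow> f i = g i"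
  shows "quad_form V X f = quad_form V Y g"
  using assms by (auto simp: quad_form_def intro!: sum.cong)

lemma psd_cong:
  assumes "\<And>i j. i \<in> V \<Longrightarrow> j \<in> V \<Longrightarrow> X i j = Y i j"
  shows "psd V X \<longleftrightarrow> psd V Y"
  using assms quad_form_cong[of V X Y] by (auto simp: psd_def)

lemma quad_form_add: "quad_form V (\<lambda>i j. X i j + Y i j) f = quad_form V X f + quad_form V Y f"
  by (simp add: quad_form_def sum.distrib algebra_simps)

lemma quad_form_scale: "quad_form V (\<lambda>i j. c * X i j) f = c * quad_form V X f"
  by (simp add: quad_form_def sum_distrib_left algebra_simps)

lemma psd_add: "psd V X \<Longrightarrow> psd V Y \<Longrightarrow> psd V (\<lambda>i j. X i j + Y i j)"
  by (auto simp: psd_def quad_form_add)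

lemma psd_scale: "psd V X \<Longrightarrow> 0 \<le> c \<Longrightarrow> psd V (\<lambda>i j. c * X i j)"
  by (auto simp: psd_def quad_form_scale)

lemma quad_form_factor:
  fixes u :: "nat \<Rightarrow> 'a \<Rightarrow> real"
  assumes "\<And>i j. i \<in> V \<Longrightarrow> j \<in> V \<Longrightarrow> X i j = (\<Sum>m<d. u m i * u m j)"
  shows "quad_form V X f = (\<Sum>m<d. (\<Sum>i\<in>V. u m i * f i)\<^sup>2)"
proof -
  have "quad_form V X f = (\<Sum>i\<in>V. \<Sum>j\<in>V. \<Sum>m<d. (u m i * f i) * (u m j * f j))"
    unfolding quad_form_def using assms
    by (intro sum.cong refl) (simp add: sum_distrib_left algebra_simps)
  also have "\<dots> = (\<Sum>m<d. \<Sum>i\<in>V. \<Sum>j\<in>V. (u m i * f i) * (u m j * f j))"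
    by (simp add: sum.swap[of _ "{..<d}"])
  finally show ?thesis
    by (simp add: power2_eq_square sum_product)
qed

lemma psd_factor:
  fixes u :: "nat \<Rightarrow> 'a \<Rightarrow> real"
  assumes "\<And>i j. i \<in> V \<Longrightarrow> j \<in> V \<Longrightarrow> X i j = (\<Sum>m<d. u m i * u m j)"
  shows "psd V X"
  using assms quad_form_factor[where V = V and X = X, OF assms]
  by (auto simp: psd_def mult.commute intro!: sum_nonneg)

lemma quad_form_insert:
  assumes "finite V" "v \<notin> V" "\<And>j. j \<in> V \<Longrightarrow> X j v = X v j"
  shows "quad_form (insert v V) X f =
    f v * f v * X v v + 2 * f v * (\<Sum>j\<in>V. f j * X v j) + quad_form V X f"
proof -
  have "(\<Sum>i\<in>V. \<Sum>j\<in>insert v V. f i * f j * X i j) =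
      (\<Sum>i\<in>V. f i * f v * X v i + (\<Sum>j\<in>V. f i * f j * X i j))"
    using assms by (intro sum.cong) auto
  also have "\<dots> = f v * (\<Sum>j\<in>V. f j * X v j) + quad_form V X f"
    by (simp add: sum.distrib quad_form_def sum_distrib_left algebra_simps)
  finally show ?thesis
    using assms by (simp add: quad_form_def sum_distrib_left algebra_simps)
qed

text \<open>Extending a test vector by 0 outside \<open>W\<close> turns the form on \<open>W\<close>
  into the form on \<open>V\<close>.\<close>

lemma psd_subset:
  assumes "psd V X" "finite V" "W \<subseteq> V"
  shows "psd W X"
proof -
  have "0 \<le> quad_form W X f" for f
  proof -
    let ?g = "\<lambda>i. if i \<in> W then f i else 0"
    have "quad_form V X ?g = (\<Sum>i\<in>V. if i \<in> W then \<Sum>j\<in>V. if j \<in> W then f i * f j * X i j else 0 else 0)"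
      unfolding quad_form_def by (intro sum.cong) (auto intro!: sum.cong)
    also have "\<dots> = quad_form W X f"
      using assms by (simp add: sum.If_cases Int_absorb1 quad_form_def)
    finally show ?thesis using psd_quad[OF assms(1)] by metis
  qed
  moreover have "\<forall>i\<in>W. \<forall>j\<in>W. X i j = X j i"
    using psd_sym[OF assms(1)] assms(3) by (meson subsetD)
  ultimately show ?thesis by (simp add: psd_def)
qed

lemma psd_diag_nonneg:
  assumes "psd V X" "finite V" "i \<in> V"
  shows "0 \<le> X i i"
  using psd_quad[OF psd_subset[OF assms(1,2), of "{i}"], of "\<lambda>_. 1"] assms
  by (simp add: quad_form_def)

text \<open>Induction by Schur complements: the row of \<open>v\<close>, divided by the square root
  of the pivot \<open>X v v\<close>, splits off a rank-one term, and the remainder is psd on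
  \<open>V\<close>. The factors are coordinates of Gram vectors, so this is how vectors are
  recovered from matrices.\<close>

lemma psd_factor_exists:
  assumes "finite V" "psd V X"
  shows "\<exists>d (u :: nat \<Rightarrow> 'a \<Rightarrow> real). \<forall>i\<in>V. \<forall>j\<in>V. X i j = (\<Sum>m<d. u m i * u m j)"
  using assms
proof (induction V arbitrary: X rule: finite_induct)
  case (insert v V)
  have sym: "\<And>j. j \<in> V \<Longrightarrow> X j v = X v j" using psd_sym[OF insert.prems] by auto
  note qi = quad_form_insert[where X = X, OF insert.hyps(1,2) sym]
  have pV: "psd V X" using psd_subset[OF insert.prems] insert.hyps by auto
  have vv: "0 \<le> X v v" using psd_diag_nonneg[OF insert.prems] insert.hyps by auto
  show ?case
  proof (cases "X v v = 0")
    case True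
    have z: "X v j = 0" if j: "j \<in> V" for j
    proof (rule ccontr)
      assume nz: "X v j \<noteq> 0"
      \<comment> \<open>The form at the vector with entry \<open>a\<close> at \<open>v\<close> and 1
        at \<open>j\<close> is then \<open>2 * a * X v j + X j j\<close>, which equals -1.\<close>
      define a where "a = - (X j j + 1) / (2 * X v j)"
      define f where "f i = (if i = v then a else if i = j then 1 else 0)" for i
      have "(\<Sum>k\<in>V. f k * X v k) = (\<Sum>k\<in>V. if k = j then X v j else 0)"
        using insert.hyps by (intro sum.cong) (auto simp: f_def)
      then have s: "(\<Sum>k\<in>V. f k * X v k) = X v j" using j insert.hyps by simp
      have "quad_form V X f = (\<Sum>i\<in>V. \<Sum>k\<in>V. if k = j then (if i = j then X j j else 0) else 0)"
        unfolding quad_form_def using insert.hyps by (intro sum.cong) (auto simp: f_def)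
      then have "quad_form V X f = X j j" using j insert.hyps by simp
      then have "quad_form (insert v V) X f = 2 * a * X v j + X j j"
        using True \<open>quad_form V X f = X j j\<close> qi[of f] s by (simp add: f_def)
      also have "\<dots> < 0" using nz by (simp add: a_def field_simps)
      finally show False using psd_quad[OF insert.prems, of f] by simp
    qed
    obtain d and u :: "nat \<Rightarrow> 'a \<Rightarrow> real"
      where u: "\<forall>i\<in>V. \<forall>j\<in>V. X i j = (\<Sum>m<d. u m i * u m j)"
      using insert.IH[OF pV] by blast
    show ?thesis
    proof (intro exI ballI)
      fix i j assume "i \<in> insert v V" "j \<in> insert v V"
      then consider "i = v" | "j = v" "i \<in> V" | "i \<in> V" "j \<in> V" by blast
      then show "X i j = (\<Sum>m<d. ((u m)(v := 0)) i * ((u m)(v := 0)) j)"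
      proof cases
        case 1
        then show ?thesis using z[of j] True \<open>j \<in> insert v V\<close> by (cases "j = v") simp_all
      next
        case 2
        then show ?thesis using z[of i] sym[of i] by simp
      next
        case 3
        then have "i \<noteq> v" "j \<noteq> v" using insert.hyps by auto
        then show ?thesis using u 3 by simp
      qed
    qed
  next
    case False
    with vv have pos: "X v v > 0" by simp
    define Y where "Y i j = X i j - X v i * X v j / X v v" for i j
    have "0 \<le> quad_form V Y f" for f
    proof -
      define b where "b = (\<Sum>j\<in>V. f j * X v j)"
      \<comment> \<open>The coordinate at \<open>v\<close> that minimises the form of
        \<open>X\<close> with the others fixed; the form of the Schur complement \<open>Y\<close> at
        \<open>f\<close> is this minimum.\<close>
      define g where "g = f(v := - b / X v v)"
      have gb: "(\<Sum>j\<in>V. g j * X v j) = b"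
        unfolding b_def using insert.hyps by (intro sum.cong) (auto simp: g_def)
      have gq: "quad_form V X g = quad_form V X f"
        using insert.hyps by (intro quad_form_cong) (auto simp: g_def)
      have "quad_form V Y f = quad_form V X f - (\<Sum>i\<in>V. \<Sum>j\<in>V. (f i * X v i) * (f j * X v j)) / X v v"
        by (simp add: quad_form_def Y_def sum_subtractf sum_divide_distrib algebra_simps)
      also have "(\<Sum>i\<in>V. \<Sum>j\<in>V. (f i * X v i) * (f j * X v j)) = b * b"
        by (simp add: b_def sum_product)
      also have "quad_form V X f - b * b / X v v = quad_form (insert v V) X g"
        using pos qi[of g] gb gq by (simp add: g_def field_simps)
      finally show ?thesis using psd_quad[OF insert.prems] by simp
    qed
    moreover have "\<forall>i\<in>V. \<forall>j\<in>V. Y i j = Y j i"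
      using psd_sym[OF pV] by (auto simp: Y_def)
    ultimately have "psd V Y" by (simp add: psd_def)
    from insert.IH[OF this] obtain d and u :: "nat \<Rightarrow> 'a \<Rightarrow> real"
      where u: "\<forall>i\<in>V. \<forall>j\<in>V. Y i j = (\<Sum>m<d. u m i * u m j)" by blast
    \<comment> \<open>The new index \<open>d\<close> carries the pivot row; the older factors are
      set to 0 at \<open>v\<close>, where \<open>u\<close> is not controlled.\<close>
    define w where "w m i = (if m < d then (if i = v then 0 else u m i) else X v i / sqrt (X v v))"
      for m i
    have "X i j = (\<Sum>m<Suc d. w m i * w m j)" if ij: "i \<in> insert v V" "j \<in> insert v V" for i j
    proof -
      have "(\<Sum>m<Suc d. w m i * w m j) =
          (\<Sum>m<d. (if i = v then 0 else u m i) * (if j = v then 0 else u m j)) + X v i * X v j / X v v"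
        using pos by (simp add: w_def)
      moreover have "(\<Sum>m<d. (if i = v then 0 else u m i) * (if j = v then 0 else u m j)) =
          X i j - X v i * X v j / X v v"
      proof (cases "i = v \<or> j = v")
        case True
        then have "X v i * X v j / X v v = X i j"
        proof
          assume "j = v"
          then show ?thesis using sym[of i] ij(1) pos by (cases "i = v") simp_all
        qed (use pos in simp)
        then show ?thesis using True by auto
      next
        case False
        then show ?thesis using u ij by (auto simp: Y_def)
      qed
      ultimately show ?thesis by simp
    qed
    then show ?thesis by blast
  qed
qed auto

section \<open>Kernels of positive semidefinite matrices\<close>

definition null_vector :: "'a set \<Rightarrow> ('a \<Rightarrow> 'a \<Rightarrow> real) \<Rightarrow> ('a \<Rightarrow> real) \<Rightarrow> bool" where
  "null_vector V X f \<longleftrightarrow> (\<forall>i\<in>V. (\<Sum>j\<in>V. X i j * f j) = 0)"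

text \<open>The form is a sum of squares, so it vanishes exactly at the linear relations among the
  Gram vectors, and these are the kernel vectors.\<close>

lemma null_vector_factor:
  fixes u :: "nat \<Rightarrow> 'a \<Rightarrow> real"
  assumes X: "\<And>i j. i \<in> V \<Longrightarrow> j \<in> V \<Longrightarrow> X i j = (\<Sum>m<d. u m i * u m j)"
  shows "null_vector V X f \<longleftrightarrow> (\<forall>m<d. (\<Sum>i\<in>V. u m i * f i) = 0)"
    and "quad_form V X f = 0 \<longleftrightarrow> (\<forall>m<d. (\<Sum>i\<in>V. u m i * f i) = 0)"
proof -
  show q: "quad_form V X f = 0 \<longleftrightarrow> (\<forall>m<d. (\<Sum>i\<in>V. u m i * f i) = 0)"
    using quad_form_factor[where V = V and X = X, OF X] by (simp add: sum_nonneg_eq_0_iff Ball_def)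
  have "(\<Sum>j\<in>V. X i j * f j) = (\<Sum>m<d. u m i * (\<Sum>j\<in>V. u m j * f j))" if "i \<in> V" for i
  proof -
    have "(\<Sum>j\<in>V. X i j * f j) = (\<Sum>j\<in>V. \<Sum>m<d. u m i * (u m j * f j))"
      using that X by (intro sum.cong) (auto simp: sum_distrib_right mult.assoc)
    then show ?thesis by (subst (asm) sum.swap) (simp add: sum_distrib_left)
  qed
  then have "(\<forall>m<d. (\<Sum>i\<in>V. u m i * f i) = 0) \<Longrightarrow> null_vector V X f"
    by (simp add: null_vector_def)
  moreover have "quad_form V X f = (\<Sum>i\<in>V. f i * (\<Sum>j\<in>V. X i j * f j))"
    by (simp add: quad_form_def sum_distrib_left algebra_simps)
  then have "null_vector V X f \<Longrightarrow> quad_form V X f = 0"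
    by (simp add: null_vector_def)
  ultimately show "null_vector V X f \<longleftrightarrow> (\<forall>m<d. (\<Sum>i\<in>V. u m i * f i) = 0)" using q by blast
qed

lemma null_vector_iff_quad_form:
  assumes "finite V" "psd V X"
  shows "null_vector V X f \<longleftrightarrow> quad_form V X f = 0"
proof -
  from psd_factor_exists[OF assms] obtain d and u :: "nat \<Rightarrow> 'a \<Rightarrow> real"
    where "\<forall>i\<in>V. \<forall>j\<in>V. X i j = (\<Sum>m<d. u m i * u m j)" by blast
  then show ?thesis using null_vector_factor[of V X u d f] by blast
qed

lemma null_vector_cong:
  assumes "\<And>i j. i \<in> V \<Longrightarrow> j \<in> V \<Longrightarrow> X i j = Y i j" "\<And>i. i \<in> V \<Longrightarrow> f i = g i"
  shows "null_vector V X f \<longleftrightarrow> null_vector V Y g"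
proof -
  have "(\<Sum>j\<in>V. X i j * f j) = (\<Sum>j\<in>V. Y i j * g j)" if "i \<in> V" for i
    using assms that by (intro sum.cong) auto
  then show ?thesis by (simp add: null_vector_def)
qed

lemma null_vector_lincomb:
  assumes "null_vector V X f" "null_vector V X g"
  shows "null_vector V X (\<lambda>i. a * f i + b * g i)"
proof -
  have "(\<Sum>j\<in>V. X i j * (a * f j + b * g j)) =
      a * (\<Sum>j\<in>V. X i j * f j) + b * (\<Sum>j\<in>V. X i j * g j)" for i
    by (simp add: sum_distrib_left sum.distrib algebra_simps)
  then show ?thesis using assms by (simp add: null_vector_def)
qed

lemma null_vector_sum:
  assumes "\<And>k. k \<in> K \<Longrightarrow> null_vector V X (f k)"
  shows "null_vector V X (\<lambda>i. \<Sum>k\<in>K. c k * f k i)"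
proof -
  have "(\<Sum>j\<in>V. X i j * (\<Sum>k\<in>K. c k * f k j)) = (\<Sum>k\<in>K. c k * (\<Sum>j\<in>V. X i j * f k j))" for i
    unfolding sum_distrib_left by (subst sum.swap) (simp add: algebra_simps)
  then show ?thesis using assms by (simp add: null_vector_def)
qed

text \<open>Both forms are nonnegative and null vectors are the zeros of the form, so no
  cancellation can occur.\<close>

lemma null_vector_add_iff:
  assumes "finite V" "psd V X" "psd V Y" "0 < a" "0 < b"
  shows "null_vector V (\<lambda>i j. a * X i j + b * Y i j) f \<longleftrightarrow> null_vector V X f \<and> null_vector V Y f"
proof -
  have q: "quad_form V (\<lambda>i j. a * X i j + b * Y i j) f = a * quad_form V X f + b * quad_form V Y f"
    by (simp add: quad_form_add quad_form_scale)
  have "0 \<le> quad_form V X f" "0 \<le> quad_form V Y f" using psd_quad assms by auto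
  then have "a * quad_form V X f + b * quad_form V Y f = 0 \<longleftrightarrow> quad_form V X f = 0 \<and> quad_form V Y f = 0"
    using assms(4,5) by (simp add: add_nonneg_eq_0_iff)
  moreover have "psd V (\<lambda>i j. a * X i j + b * Y i j)"
    using assms by (intro psd_add psd_scale) auto
  ultimately show ?thesis
    using assms(1-3) q by (simp add: null_vector_iff_quad_form)
qed

lemma psd_zero_diag:
  assumes "finite V" "psd V X" "i \<in> V" "j \<in> V" "X i i = 0"
  shows "X i j = 0"
proof -
  from psd_factor_exists[OF assms(1,2)] obtain d and u :: "nat \<Rightarrow> 'a \<Rightarrow> real"
    where u: "\<forall>i\<in>V. \<forall>j\<in>V. X i j = (\<Sum>m<d. u m i * u m j)" by blast
  then have "(\<Sum>m<d. u m i * u m i) = 0" using assms by auto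
  then have "\<forall>m<d. u m i = 0" by (subst (asm) sum_nonneg_eq_0_iff) auto
  then show ?thesis using u assms by auto
qed

text \<open>Expands the squared norms of the sum and the difference of two Gram vectors. A bounded
  diagonal thus bounds all entries, which the compactness arguments rely on.\<close>

lemma psd_offdiag_bound:
  assumes "finite V" "psd V X" "i \<in> V" "j \<in> V"
  shows "2 * \<bar>X i j\<bar> \<le> X i i + X j j"
proof -
  from psd_factor_exists[OF assms(1,2)] obtain d and u :: "nat \<Rightarrow> 'a \<Rightarrow> real"
    where u: "\<forall>i\<in>V. \<forall>j\<in>V. X i j = (\<Sum>m<d. u m i * u m j)" by blast
  have "0 \<le> (\<Sum>m<d. (u m i + u m j)\<^sup>2)" "0 \<le> (\<Sum>m<d. (u m i - u m j)\<^sup>2)"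
    by (auto intro: sum_nonneg)
  moreover have "(\<Sum>m<d. (u m i + u m j)\<^sup>2) = X i i + X j j + 2 * X i j"
    using u assms by (simp add: power2_eq_square algebra_simps sum.distrib sum_distrib_left)
  moreover have "(\<Sum>m<d. (u m i - u m j)\<^sup>2) = X i i + X j j - 2 * X i j"
    using u assms by (simp add: power2_eq_square algebra_simps sum.distrib sum_subtractf sum_distrib_left)
  ultimately show ?thesis by linarith
qed

section \<open>The rank of a positive semidefinite matrix\<close>

text \<open>Linear independence of the columns of \<open>X\<close> indexed by \<open>S\<close>,
  expressed by kernel vectors supported in \<open>S\<close>. The largest size of such a set is the
  column rank.\<close>

definition null_free :: "'a set \<Rightarrow> ('a \<Rightarrow> 'a \<Rightarrow> real) \<Rightarrow> 'a set \<Rightarrow> bool" where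
  "null_free V X S \<longleftrightarrow> S \<subseteq> V \<and>
     (\<forall>f. null_vector V X f \<longrightarrow> (\<forall>i\<in>V - S. f i = 0) \<longrightarrow> (\<forall>i\<in>S. f i = 0))"

definition psd_rank :: "'a set \<Rightarrow> ('a \<Rightarrow> 'a \<Rightarrow> real) \<Rightarrow> nat" where
  "psd_rank V X = Max (card ` {S. null_free V X S})"

lemma null_freeD:
  "null_free V X S \<Longrightarrow> null_vector V X f \<Longrightarrow> (\<And>i. i \<in> V - S \<Longrightarrow> f i = 0) \<Longrightarrow> i \<in> V \<Longrightarrow> f i = 0"
  by (auto simp: null_free_def)

lemma finite_null_free: "finite V \<Longrightarrow> finite {S. null_free V X S}"
  by (rule finite_subset[of _ "Pow V"]) (auto simp: null_free_def)

lemma null_free_card_le: "finite V \<Longrightarrow> null_free V X S \<Longrightarrow> card S \<le> psd_rank V X"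
  unfolding psd_rank_def by (rule Max_ge) (auto simp: finite_null_free)

lemma psd_rank_attained:
  assumes "finite V"
  obtains S where "null_free V X S" "card S = psd_rank V X"
proof -
  have "null_free V X {}" by (auto simp: null_free_def)
  then have "psd_rank V X \<in> card ` {S. null_free V X S}"
    unfolding psd_rank_def using assms finite_null_free by (intro Max_in) auto
  then show ?thesis using that by auto
qed

lemma psd_rank_le_card:
  assumes "finite V" shows "psd_rank V X \<le> card V"
proof -
  obtain S where "null_free V X S" "card S = psd_rank V X" using psd_rank_attained[OF assms] .
  then show ?thesis using assms by (metis card_mono null_free_def)
qed

lemma psd_rank_cong:
  assumes "\<And>i j. i \<in> V \<Longrightarrow> j \<in> V \<Longrightarrow> X i j = Y i j"
  shows "psd_rank V X = psd_rank V Y"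
proof -
  have "null_vector V X f = null_vector V Y f" for f using assms by (intro null_vector_cong) auto
  then show ?thesis by (simp add: psd_rank_def null_free_def)
qed

text \<open>Adjoining \<open>v\<close> to an independent set of largest size creates a kernel vector
  supported on \<open>insert v S\<close>; independence of \<open>S\<close> makes its entry at
  \<open>v\<close> nonzero, and it is scaled to 1 there.\<close>

lemma maximum_null_free_relation:
  assumes "finite V" "null_free V X S" "card S = psd_rank V X" "v \<in> V - S"
  obtains r where "null_vector V X r" "r v = 1" "\<And>i. i \<in> V - S \<Longrightarrow> i \<noteq> v \<Longrightarrow> r i = 0"
proof -
  have fS: "finite S" using assms by (auto simp: null_free_def intro: finite_subset)
  have "\<not> null_free V X (insert v S)"
  proof
    assume "null_free V X (insert v S)"
    then have "card (insert v S) \<le> card S" using null_free_card_le assms by metis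
    then show False using fS assms(4) by simp
  qed
  then obtain f where f: "null_vector V X f" "\<forall>i\<in>V - insert v S. f i = 0"
    "\<exists>i\<in>insert v S. f i \<noteq> 0"
    using assms(2,4) unfolding null_free_def by blast
  have "f v \<noteq> 0"
  proof
    assume "f v = 0"
    then have "\<forall>i\<in>V - S. f i = 0" using f(2) by auto
    then have "\<forall>i\<in>S. f i = 0" using assms(2) f(1) unfolding null_free_def by blast
    then show False using f(3) \<open>f v = 0\<close> by auto
  qed
  show ?thesis
  proof (rule that[of "\<lambda>i. (1 / f v) * f i + 0 * f i"])
    show "null_vector V X (\<lambda>i. (1 / f v) * f i + 0 * f i)"
      using f(1) by (intro null_vector_lincomb)
  qed (use f \<open>f v \<noteq> 0\<close> in auto)
qed

text \<open>The \<open>r v\<close> form a basis of the kernel dual to the coordinates outside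
  \<open>S\<close>: subtracting the combination with coefficients \<open>f v\<close> leaves a kernel
  vector supported in \<open>S\<close>, which is 0.\<close>

lemma maximum_null_free_relations:
  assumes "finite V" "null_free V X S" "card S = psd_rank V X"
  shows "\<exists>r. (\<forall>v\<in>V - S. null_vector V X (r v) \<and> r v v = 1 \<and> (\<forall>i\<in>V - S. i \<noteq> v \<longrightarrow> r v i = 0)) \<and>
    (\<forall>f i. null_vector V X f \<longrightarrow> i \<in> V \<longrightarrow> f i = (\<Sum>v\<in>V - S. f v * r v i))"
proof -
  have "\<forall>v\<in>V - S. \<exists>r. null_vector V X r \<and> r v = 1 \<and> (\<forall>i\<in>V - S. i \<noteq> v \<longrightarrow> r i = 0)"
    using maximum_null_free_relation[OF assms] by metis
  from bchoice[OF this] obtain r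
    where rel: "\<forall>v\<in>V - S. null_vector V X (r v) \<and> r v v = 1 \<and> (\<forall>i\<in>V - S. i \<noteq> v \<longrightarrow> r v i = 0)"
    by blast
  then have r: "\<And>v. v \<in> V - S \<Longrightarrow> null_vector V X (r v)"
    "\<And>v. v \<in> V - S \<Longrightarrow> r v v = 1"
    "\<And>v i. v \<in> V - S \<Longrightarrow> i \<in> V - S \<Longrightarrow> i \<noteq> v \<Longrightarrow> r v i = 0"
    by blast+
  have "f i = (\<Sum>v\<in>V - S. f v * r v i)" if f: "null_vector V X f" and i: "i \<in> V" for f i
  proof -
    let ?g = "\<lambda>i. 1 * f i + (-1) * (\<Sum>v\<in>V - S. f v * r v i)"
    have "null_vector V X ?g"
      using f r(1) by (intro null_vector_lincomb null_vector_sum) auto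
    moreover have "?g k = 0" if k: "k \<in> V - S" for k
    proof -
      have "(\<Sum>v\<in>V - S. f v * r v k) = (\<Sum>v\<in>V - S. if v = k then f k else 0)"
        using r k by (intro sum.cong) auto
      then show ?thesis using k assms(1) by simp
    qed
    ultimately have "?g i = 0" using null_freeD[OF assms(2)] i by blast
    then show ?thesis by simp
  qed
  then show ?thesis using rel by blast
qed

text \<open>The kernel of the combination lies in that of \<open>X\<close>, so a largest independent
  set \<open>S\<close> for \<open>X\<close> stays independent for the combination, and the rank
  bound makes it a largest one there too. Both kernels are then parametrised by the same free
  coordinates outside \<open>S\<close>, so they agree, and the kernel of the combination lies in
  that of \<open>Y\<close>.\<close>

lemma null_vector_mono:
  assumes "finite V" "psd V X" "psd V Y" "0 < a" "0 < b"
    and le: "psd_rank V (\<lambda>i j. a * X i j + b * Y i j) \<le> psd_rank V X"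
    and f: "null_vector V X f"
  shows "null_vector V Y f"
proof -
  let ?Z = "\<lambda>i j. a * X i j + b * Y i j"
  note iff = null_vector_add_iff[OF assms(1-5)]
  obtain S where S: "null_free V X S" "card S = psd_rank V X" using psd_rank_attained[OF assms(1)] .
  then have SZ: "null_free V ?Z S" using iff by (auto simp: null_free_def)
  then have "card S = psd_rank V ?Z" using null_free_card_le[OF assms(1) SZ] le S by simp
  then obtain r
    where rel: "\<forall>v\<in>V - S. null_vector V ?Z (r v) \<and> r v v = 1 \<and> (\<forall>i\<in>V - S. i \<noteq> v \<longrightarrow> r v i = 0)"
    using maximum_null_free_relations[OF assms(1) SZ] by blast
  have r: "\<And>v. v \<in> V - S \<Longrightarrow> null_vector V ?Z (r v)"
    "\<And>v. v \<in> V - S \<Longrightarrow> r v v = 1"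
    "\<And>v i. v \<in> V - S \<Longrightarrow> i \<in> V - S \<Longrightarrow> i \<noteq> v \<Longrightarrow> r v i = 0"
    using rel by blast+
  let ?h = "\<lambda>i. \<Sum>v\<in>V - S. f v * r v i"
  have hX: "null_vector V X ?h" and hY: "null_vector V Y ?h"
    using r(1) iff by (auto intro!: null_vector_sum)
  have "1 * f i + (-1) * ?h i = 0" if "i \<in> V" for i
  proof (rule null_freeD[OF S(1) null_vector_lincomb[OF f hX] _ that])
    fix k assume k: "k \<in> V - S"
    have "(\<Sum>v\<in>V - S. f v * r v k) = (\<Sum>v\<in>V - S. if v = k then f k else 0)"
      using r k by (intro sum.cong) auto
    then show "1 * f k + (-1) * ?h k = 0" using k assms(1) by simp
  qed
  then have "f i = ?h i" if "i \<in> V" for i using that by (simp only: mult_1 mult_minus1 add_uminus_conv_diff right_minus_eq)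
  then have "null_vector V Y f \<longleftrightarrow> null_vector V Y ?h" by (rule null_vector_cong[OF refl])
  then show ?thesis using hY by blast
qed

text \<open>As many equations as the rank suffice for membership in the kernel, since the
  coordinates outside \<open>S\<close> determine the others. This number enters the count in
  \<open>psd_rank_induced_sum_le\<close>.\<close>

lemma null_vector_equations:
  assumes "finite V"
  obtains S and c :: "'a \<Rightarrow> 'a \<Rightarrow> real" where "finite S" "card S = psd_rank V X"
    "\<And>f. (\<And>s. s \<in> S \<Longrightarrow> (\<Sum>j\<in>V. c s j * f j) = 0) \<Longrightarrow> null_vector V X f"
proof -
  obtain S where S: "null_free V X S" "card S = psd_rank V X" using psd_rank_attained[OF assms] .
  then obtain r
    where rel: "\<forall>v\<in>V - S. null_vector V X (r v) \<and> r v v = 1 \<and> (\<forall>i\<in>V - S. i \<noteq> v \<longrightarrow> r v i = 0)"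
    using maximum_null_free_relations[OF assms] by blast
  have r: "\<And>v. v \<in> V - S \<Longrightarrow> null_vector V X (r v)"
    "\<And>v. v \<in> V - S \<Longrightarrow> r v v = 1"
    "\<And>v i. v \<in> V - S \<Longrightarrow> i \<in> V - S \<Longrightarrow> i \<noteq> v \<Longrightarrow> r v i = 0"
    using rel by blast+
  have SV: "S \<subseteq> V" using S by (simp add: null_free_def)
  \<comment> \<open>The equation of \<open>s\<close> reads
    \<open>f s = (\<Sum>j\<in>V - S. f j * r j s)\<close>.\<close>
  define c where "c s j = (if j \<in> S then (if j = s then 1 else 0) else - r j s)" for s j
  show ?thesis
  proof (rule that[of S c])
    show "finite S" using SV assms finite_subset by blast
    fix f assume f: "\<And>s. s \<in> S \<Longrightarrow> (\<Sum>j\<in>V. c s j * f j) = 0"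
    have "f i = (\<Sum>v\<in>V - S. f v * r v i)" if i: "i \<in> V" for i
    proof (cases "i \<in> S")
      case True
      have "(\<Sum>j\<in>V. c i j * f j) = (\<Sum>j\<in>V - S. c i j * f j) + (\<Sum>j\<in>S. c i j * f j)"
        using SV assms by (simp add: sum.subset_diff)
      also have "(\<Sum>j\<in>V - S. c i j * f j) = - (\<Sum>j\<in>V - S. f j * r j i)"
        by (simp add: c_def sum_negf mult.commute)
      also have "(\<Sum>j\<in>S. c i j * f j) = (\<Sum>j\<in>S. if j = i then f i else 0)"
        by (intro sum.cong) (auto simp: c_def)
      also have "\<dots> = f i" using True SV assms finite_subset by (subst sum.delta) auto
      finally show ?thesis using f[OF True] by simp
    next
      case False
      then have "(\<Sum>v\<in>V - S. f v * r v i) = (\<Sum>v\<in>V - S. if v = i then f i else 0)"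
        using r i by (intro sum.cong) auto
      then show ?thesis using False i assms by simp
    qed
    then have "null_vector V X f \<longleftrightarrow> null_vector V X (\<lambda>i. \<Sum>v\<in>V - S. f v * r v i)"
      by (rule null_vector_cong[OF refl])
    moreover have "null_vector V X (\<lambda>i. \<Sum>v\<in>V - S. f v * r v i)"
      using r(1) by (rule null_vector_sum)
    ultimately show "null_vector V X f" by blast
  qed (use S in auto)
qed

text \<open>Gaussian elimination: a pivot removes one equation together with one unknown.\<close>

lemma underdetermined_system:
  fixes a :: "'e \<Rightarrow> 'r \<Rightarrow> real"
  assumes "finite E" "finite R" "card E < card R"
  shows "\<exists>c. (\<exists>r\<in>R. c r \<noteq> 0) \<and> (\<forall>e\<in>E. (\<Sum>r\<in>R. a e r * c r) = 0)"
  using assms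
proof (induction E arbitrary: R a rule: finite_induct)
  case empty
  then have "R \<noteq> {}" by auto
  then show ?case by (intro exI[of _ "\<lambda>_. 1"]) auto
next
  case (insert e E)
  show ?case
  proof (cases "\<forall>r\<in>R. a e r = 0")
    case True
    have "card E < card R" using insert by simp
    from insert.IH[OF insert.prems(1) this, of a] True show ?thesis by auto
  next
    case False
    then obtain q where q: "q \<in> R" "a e q \<noteq> 0" by auto
    define a' where "a' e' r = a e' r - a e' q * a e r / a e q" for e' r
    have "card E < card (R - {q})" using insert q by simp
    from insert.IH[OF _ this, of a'] insert.prems(1) obtain c
      where c: "\<exists>r\<in>R - {q}. c r \<noteq> 0" "\<forall>e\<in>E. (\<Sum>r\<in>R - {q}. a' e r * c r) = 0" by auto
    define z where "z = (\<Sum>r\<in>R - {q}. a e r * c r)"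
    \<comment> \<open>The value of the eliminated unknown is forced by the pivot equation
      \<open>e\<close>.\<close>
    define c' where "c' = c(q := - z / a e q)"
    have eq: "(\<Sum>r\<in>R. a e' r * c' r) = (\<Sum>r\<in>R - {q}. a e' r * c r) - a e' q * z / a e q" for e'
    proof -
      have "(\<Sum>r\<in>R - {q}. a e' r * c' r) = (\<Sum>r\<in>R - {q}. a e' r * c r)"
        by (intro sum.cong) (auto simp: c'_def)
      then show ?thesis
        using q insert.prems(1) by (simp add: sum.remove[of R q] c'_def)
    qed
    have "(\<Sum>r\<in>R. a e' r * c' r) = 0" if "e' \<in> E" for e'
    proof -
      have "(\<Sum>r\<in>R - {q}. a' e' r * c r) = (\<Sum>r\<in>R - {q}. a e' r * c r) - a e' q * z / a e q"
        by (simp add: a'_def z_def algebra_simps sum_subtractf sum_distrib_left sum_divide_distrib)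
      then show ?thesis using c that eq by simp
    qed
    moreover have "(\<Sum>r\<in>R. a e r * c' r) = 0" using q by (simp add: eq z_def)
    moreover have "\<exists>r\<in>R. c' r \<noteq> 0" using c by (auto simp: c'_def)
    ultimately show ?thesis by blast
  qed
qed

subsection \<open>Ranks of combinations of induced Gram matrices\<close>

text \<open>The matrix occurring in \<open>convex_combination_of_induced\<close>, with free
  coefficients so that either summand can be isolated by the choice 1 and 0.\<close>

definition induced_sum ::
    "real \<Rightarrow> ('a \<Rightarrow> 'a \<Rightarrow> real) \<Rightarrow> real \<Rightarrow> ('b \<Rightarrow> 'b \<Rightarrow> real) \<Rightarrow> 'a \<times> 'b \<Rightarrow> 'a \<times> 'b \<Rightarrow> real" where
  "induced_sum \<alpha> M \<beta> N x y = \<alpha> * kronecker M all_ones x y + \<beta> * kronecker all_ones N x y"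

lemma sum_Times: "(\<Sum>x\<in>A \<times> B. g x) = (\<Sum>i\<in>A. \<Sum>l\<in>B. g (i, l))"
  by (simp add: sum.cartesian_product)

text \<open>Factoring \<open>X\<close> alone suffices: the form at \<open>f\<close> is the sum over
  \<open>m\<close> of the form of \<open>Y\<close> at the contraction of \<open>f\<close> with
  \<open>u m\<close> in the first coordinate.\<close>

lemma psd_kronecker:
  assumes "finite V" "finite W" "psd V X" "psd W Y"
  shows "psd (V \<times> W) (kronecker X Y)"
proof -
  from psd_factor_exists[OF assms(1,3)] obtain d and u :: "nat \<Rightarrow> 'a \<Rightarrow> real"
    where u: "\<forall>i\<in>V. \<forall>j\<in>V. X i j = (\<Sum>m<d. u m i * u m j)" by blast
  have prod: "(\<Sum>i\<in>V. \<Sum>j\<in>V. a i * b j * y) = (\<Sum>i\<in>V. a i) * (\<Sum>j\<in>V. b j) * y"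
    for a b :: "'a \<Rightarrow> real" and y
    unfolding sum_product unfolding sum_distrib_right ..
  have "quad_form (V \<times> W) (kronecker X Y) f =
      (\<Sum>m<d. quad_form W Y (\<lambda>l. \<Sum>i\<in>V. u m i * f (i, l)))" for f
  proof -
    have "quad_form (V \<times> W) (kronecker X Y) f =
        (\<Sum>i\<in>V. \<Sum>l\<in>W. \<Sum>j\<in>V. \<Sum>k\<in>W. f (i, l) * f (j, k) * (X i j * Y l k))"
      by (simp add: quad_form_def kronecker_def sum_Times)
    also have "\<dots> = (\<Sum>i\<in>V. \<Sum>l\<in>W. \<Sum>j\<in>V. \<Sum>k\<in>W. \<Sum>m<d. (u m i * f (i, l)) * (u m j * f (j, k)) * Y l k)"
      using u by (intro sum.cong refl) (simp add: sum_distrib_left sum_distrib_right mult_ac)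
    also have "\<dots> = (\<Sum>m<d. \<Sum>l\<in>W. \<Sum>k\<in>W. \<Sum>i\<in>V. \<Sum>j\<in>V. (u m i * f (i, l)) * (u m j * f (j, k)) * Y l k)"
      by (simp only: sum.swap[of _ "{..<d}" V] sum.swap[of _ "{..<d}" W] sum.swap[of _ W V])
    also have "\<dots> = (\<Sum>m<d. quad_form W Y (\<lambda>l. \<Sum>i\<in>V. u m i * f (i, l)))"
      by (simp only: quad_form_def prod)
    finally show ?thesis .
  qed
  then have "0 \<le> quad_form (V \<times> W) (kronecker X Y) f" for f
    using psd_quad[OF assms(4)] by (simp add: sum_nonneg)
  moreover have "kronecker X Y x y = kronecker X Y y x" if "x \<in> V \<times> W" "y \<in> V \<times> W" for x y
    using that psd_sym[OF assms(3), of "fst x" "fst y"] psd_sym[OF assms(4), of "snd x" "snd y"]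
    by (auto simp: kronecker_def)
  ultimately show ?thesis by (simp add: psd_def)
qed

lemma psd_all_ones: "psd V all_ones"
  using psd_factor[where V = V and X = all_ones and d = 1 and u = "\<lambda>_ _. 1"]
  by (simp add: all_ones_def)

lemma psd_induced_sum:
  assumes "finite V" "finite W" "psd V M" "psd W N" "0 \<le> \<alpha>" "0 \<le> \<beta>"
  shows "psd (V \<times> W) (induced_sum \<alpha> M \<beta> N)"
proof -
  have "psd (V \<times> W) (\<lambda>x y. \<alpha> * kronecker M all_ones x y + \<beta> * kronecker all_ones N x y)"
    using assms by (intro psd_add psd_scale psd_kronecker psd_all_ones)
  then show ?thesis by (simp add: induced_sum_def[abs_def])
qed

text \<open>Tensoring with an all-ones matrix sums out a coordinate, so the matrix sees
  \<open>c\<close> only through its two marginals.\<close>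

lemma induced_sum_mult:
  shows "(\<Sum>y\<in>V \<times> W. induced_sum \<alpha> M \<beta> N (i, l) y * c y) =
    \<alpha> * (\<Sum>j\<in>V. M i j * (\<Sum>k\<in>W. c (j, k))) + \<beta> * (\<Sum>k\<in>W. N l k * (\<Sum>j\<in>V. c (j, k)))"
proof -
  have "(\<Sum>y\<in>V \<times> W. induced_sum \<alpha> M \<beta> N (i, l) y * c y) =
      (\<Sum>j\<in>V. \<Sum>k\<in>W. \<alpha> * (M i j * c (j, k)) + \<beta> * (N l k * c (j, k)))"
    by (simp add: sum_Times induced_sum_def kronecker_def all_ones_def algebra_simps)
  also have "\<dots> = (\<Sum>j\<in>V. \<Sum>k\<in>W. \<alpha> * (M i j * c (j, k))) + (\<Sum>k\<in>W. \<Sum>j\<in>V. \<beta> * (N l k * c (j, k)))"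
    by (simp add: sum.distrib sum.swap[of _ W V])
  finally show ?thesis by (simp add: sum_distrib_left)
qed

lemma null_vector_induced_sum:
  assumes "null_vector V M (\<lambda>j. \<Sum>k\<in>W. c (j, k))" "null_vector W N (\<lambda>k. \<Sum>j\<in>V. c (j, k))"
  shows "null_vector (V \<times> W) (induced_sum \<alpha> M \<beta> N) c"
  using assms by (auto simp: null_vector_def induced_sum_mult)

text \<open>Both summands are psd, so each of them annihilates \<open>c\<close>. A row over a given
  vertex of one factor exists because the other factor is nonempty.\<close>

lemma null_vector_marginals:
  assumes fin: "finite V" "finite W" and ne: "V \<noteq> {}" "W \<noteq> {}" and "psd V M" "psd W N" "0 < \<alpha>" "0 < \<beta>"
    and c: "null_vector (V \<times> W) (induced_sum \<alpha> M \<beta> N) c"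
  shows "null_vector V M (\<lambda>j. \<Sum>k\<in>W. c (j, k))" "null_vector W N (\<lambda>k. \<Sum>j\<in>V. c (j, k))"
proof -
  have p1: "psd (V \<times> W) (induced_sum 1 M 0 N)" and p2: "psd (V \<times> W) (induced_sum 0 M 1 N)"
    using assms by (auto intro: psd_induced_sum)
  have "induced_sum \<alpha> M \<beta> N = (\<lambda>x y. \<alpha> * induced_sum 1 M 0 N x y + \<beta> * induced_sum 0 M 1 N x y)"
    by (simp add: induced_sum_def[abs_def])
  then have "null_vector (V \<times> W) (induced_sum 1 M 0 N) c" "null_vector (V \<times> W) (induced_sum 0 M 1 N) c"
    using c null_vector_add_iff[OF _ p1 p2 assms(7,8)] fin by auto
  then show "null_vector V M (\<lambda>j. \<Sum>k\<in>W. c (j, k))" "null_vector W N (\<lambda>k. \<Sum>j\<in>V. c (j, k))"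
    using ne by (auto simp: null_vector_def induced_sum_mult)
qed

text \<open>By a dimension count: \<open>psd_rank V M + psd_rank W N\<close> equations force both
  marginals into the kernels. A larger independent set would support a nonzero solution of them,
  that is, a nonzero kernel vector.\<close>

lemma psd_rank_induced_sum_le:
  assumes "finite V" "finite W"
  shows "psd_rank (V \<times> W) (induced_sum \<alpha> M \<beta> N) \<le> psd_rank V M + psd_rank W N"
proof (rule ccontr)
  assume neg: "\<not> ?thesis"
  have fin: "finite (V \<times> W)" using assms by simp
  obtain R where R: "null_free (V \<times> W) (induced_sum \<alpha> M \<beta> N) R"
    "card R = psd_rank (V \<times> W) (induced_sum \<alpha> M \<beta> N)" using psd_rank_attained[OF fin] .
  have RV: "R \<subseteq> V \<times> W" using R by (simp add: null_free_def)
  obtain S and c :: "'a \<Rightarrow> 'a \<Rightarrow> real" where S: "finite S" "card S = psd_rank V M"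
    "\<And>f. (\<And>s. s \<in> S \<Longrightarrow> (\<Sum>j\<in>V. c s j * f j) = 0) \<Longrightarrow> null_vector V M f"
    using null_vector_equations[OF assms(1), of M] by blast
  obtain T and e :: "'b \<Rightarrow> 'b \<Rightarrow> real" where T: "finite T" "card T = psd_rank W N"
    "\<And>f. (\<And>s. s \<in> T \<Longrightarrow> (\<Sum>j\<in>W. e s j * f j) = 0) \<Longrightarrow> null_vector W N f"
    using null_vector_equations[OF assms(2), of N] by blast
  \<comment> \<open>The disjoint sum indexes the equations of both factors; each is lifted to the
    product by reading one coordinate of \<open>x\<close>.\<close>
  define a where "a q x = (case q of Inl s \<Rightarrow> c s (fst x) | Inr t \<Rightarrow> e t (snd x))" for q and x :: "'a \<times> 'b"
  have "card (S <+> T) < card R" using S T R neg by (simp add: card_Plus)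
  moreover have "finite R" using RV fin finite_subset by blast
  ultimately obtain g where g: "\<exists>x\<in>R. g x \<noteq> 0" "\<forall>q\<in>S <+> T. (\<Sum>x\<in>R. a q x * g x) = 0"
    using underdetermined_system[of "S <+> T" R a] S(1) T(1) by auto
  define h where "h x = (if x \<in> R then g x else 0)" for x
  have h: "(\<Sum>x\<in>V \<times> W. a q x * h x) = 0" if "q \<in> S <+> T" for q
  proof -
    have "(\<Sum>x\<in>V \<times> W. a q x * h x) = (\<Sum>x\<in>R. a q x * g x)"
      using RV fin by (intro sum.mono_neutral_cong_right) (auto simp: h_def)
    then show ?thesis using g that by simp
  qed
  have "null_vector V M (\<lambda>j. \<Sum>k\<in>W. h (j, k))"
  proof (rule S(3))
    fix s assume "s \<in> S"
    then show "(\<Sum>j\<in>V. c s j * (\<Sum>k\<in>W. h (j, k))) = 0"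
      using h[of "Inl s"] by (simp add: a_def sum_Times sum_distrib_left InlI)
  qed
  moreover have "null_vector W N (\<lambda>k. \<Sum>j\<in>V. h (j, k))"
  proof (rule T(3))
    fix t assume "t \<in> T"
    then show "(\<Sum>k\<in>W. e t k * (\<Sum>j\<in>V. h (j, k))) = 0"
      using h[of "Inr t"] sum.swap[of "\<lambda>j k. e t k * h (j, k)" W V]
      by (simp add: a_def sum_Times sum_distrib_left InrI)
  qed
  ultimately have "null_vector (V \<times> W) (induced_sum \<alpha> M \<beta> N) h" by (rule null_vector_induced_sum)
  moreover have "h x = 0" if "x \<in> V \<times> W - R" for x using that by (simp add: h_def)
  ultimately have "h x = 0" if "x \<in> V \<times> W" for x using null_freeD[OF R(1)] that by blast
  then have "g x = 0" if "x \<in> R" for x using that RV by (metis h_def subsetD)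
  then show False using g by blast
qed

text \<open>The vector \<open>w\<close> keeps the all-ones vector out of the column space of
  \<open>M\<close>. Concretely, a cross-shaped set of pairs is independent, because the marginals of
  a kernel vector supported on it vanish one after the other.\<close>

lemma psd_rank_induced_sum_ge:
  assumes fin: "finite V" "finite W" and psd: "psd V M" "psd W N" and pos: "0 < \<alpha>" "0 < \<beta>"
    and w: "null_vector V M w" "(\<Sum>i\<in>V. w i) \<noteq> 0" and N: "0 < psd_rank W N"
  shows "psd_rank V M + psd_rank W N \<le> psd_rank (V \<times> W) (induced_sum \<alpha> M \<beta> N)"
proof -
  obtain S where S: "null_free V M S" "card S = psd_rank V M" using psd_rank_attained[OF fin(1)] .
  obtain T where T: "null_free W N T" "card T = psd_rank W N" using psd_rank_attained[OF fin(2)] .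
  have SV: "S \<subseteq> V" "T \<subseteq> W" using S T by (auto simp: null_free_def)
  have finST: "finite S" "finite T" using SV fin finite_subset by auto
  obtain r
    where rel: "\<forall>v\<in>V - S. null_vector V M (r v) \<and> r v v = 1 \<and> (\<forall>i\<in>V - S. i \<noteq> v \<longrightarrow> r v i = 0)"
      "\<forall>f i. null_vector V M f \<longrightarrow> i \<in> V \<longrightarrow> f i = (\<Sum>v\<in>V - S. f v * r v i)"
    using maximum_null_free_relations[OF fin(1) S] by blast
  have r: "\<And>v. v \<in> V - S \<Longrightarrow> null_vector V M (r v)"
    "\<And>f i. null_vector V M f \<Longrightarrow> i \<in> V \<Longrightarrow> f i = (\<Sum>v\<in>V - S. f v * r v i)"
    "\<And>v. v \<in> V - S \<Longrightarrow> r v v = 1"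
    "\<And>v i. v \<in> V - S \<Longrightarrow> i \<in> V - S \<Longrightarrow> i \<noteq> v \<Longrightarrow> r v i = 0"
    using rel by blast+
  \<comment> \<open>Otherwise \<open>w\<close>, a combination of these relations, would have sum 0
    as well.\<close>
  have "\<exists>v\<in>V - S. (\<Sum>i\<in>V. r v i) \<noteq> 0"
  proof (rule ccontr)
    assume "\<not> ?thesis"
    then have z: "(\<Sum>v\<in>V - S. w v * (\<Sum>i\<in>V. r v i)) = 0" by simp
    have "(\<Sum>i\<in>V. w i) = (\<Sum>i\<in>V. \<Sum>v\<in>V - S. w v * r v i)"
      by (intro sum.cong refl) (rule r(2)[OF w(1)])
    also have "\<dots> = (\<Sum>v\<in>V - S. w v * (\<Sum>i\<in>V. r v i))"
      by (subst sum.swap) (simp add: sum_distrib_left)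
    finally show False using z w by simp
  qed
  then obtain p where p: "p \<in> V - S" "(\<Sum>i\<in>V. r p i) \<noteq> 0" by blast
  from T N have "T \<noteq> {}" by auto
  then obtain q where q: "q \<in> T" by auto
  \<comment> \<open>With both p and q outside S and T the union can be dependent, as for K2 x K2; taking q in T
    forces the relation on S \<union> {p} to have sum zero.\<close>
  define R where "R = S \<times> {q} \<union> {p} \<times> T"
  have RV: "R \<subseteq> V \<times> W" using SV p q by (auto simp: R_def)
  have "card R = card (S \<times> {q}) + card ({p} \<times> T)"
    unfolding R_def using finST p by (intro card_Un_disjoint) auto
  then have card: "card R = psd_rank V M + psd_rank W N" using S T by (simp add: card_cartesian_product)
  have "null_free (V \<times> W) (induced_sum \<alpha> M \<beta> N) R"
    unfolding null_free_def
  proof (intro conjI allI impI RV)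
    fix c assume c: "null_vector (V \<times> W) (induced_sum \<alpha> M \<beta> N) c" and z: "\<forall>x\<in>V \<times> W - R. c x = 0"
    let ?a = "\<lambda>j. \<Sum>k\<in>W. c (j, k)" and ?b = "\<lambda>k. \<Sum>j\<in>V. c (j, k)"
    have ne: "V \<noteq> {}" "W \<noteq> {}" using p q SV by auto
    have a: "null_vector V M ?a" and b: "null_vector W N ?b"
      using null_vector_marginals[OF fin ne psd pos c] by auto
    \<comment> \<open>As \<open>q\<close> lies in \<open>T\<close>, no point of \<open>R\<close>
      lies over a vertex outside \<open>T\<close>.\<close>
    have "?b l = 0" if "l \<in> W - T" for l
      using that z q by (intro sum.neutral) (auto simp: R_def)
    then have b0: "?b l = 0" if "l \<in> W" for l using null_freeD[OF T(1) b] that by blast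
    \<comment> \<open>Both marginals have the same total; this transfers information from one factor
      to the other.\<close>
    then have "(\<Sum>l\<in>W. ?b l) = 0" by simp
    then have sa: "(\<Sum>i\<in>V. ?a i) = 0" by (subst sum.swap)
    have ap: "?a i = ?a p * r p i" if i: "i \<in> V" for i
    proof -
      have "?a v = 0" if "v \<in> V - S" "v \<noteq> p" for v
        using that z by (intro sum.neutral) (auto simp: R_def)
      then have "(\<Sum>v\<in>V - S. ?a v * r v i) = (\<Sum>v\<in>V - S. if v = p then ?a p * r p i else 0)"
        by (intro sum.cong) auto
      also have "\<dots> = ?a p * r p i" using p fin by simp
      finally show ?thesis using r(2)[OF a i] by (rule trans[rotated])
    qed
    have "(\<Sum>i\<in>V. ?a i) = ?a p * (\<Sum>i\<in>V. r p i)"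
      unfolding sum_distrib_left using ap by (intro sum.cong) auto
    then have "?a p = 0" using sa p by simp
    then have a0: "?a i = 0" if "i \<in> V" for i using ap that by simp
    \<comment> \<open>The row of \<open>i\<close> meets \<open>R\<close> in \<open>(i, q)\<close>
      alone, so this entry is the marginal. Once these entries vanish, each column over
      \<open>T\<close> keeps only its entry at \<open>p\<close>.\<close>
    have 1: "c (i, q) = 0" if "i \<in> S" for i
    proof -
      have "i \<noteq> p" "i \<in> V" using that p SV by auto
      then have "?a i = (\<Sum>k\<in>W. if k = q then c (i, q) else 0)"
        using z by (intro sum.cong) (auto simp: R_def)
      then show ?thesis using a0[OF \<open>i \<in> V\<close>] q SV fin by (auto simp: sum.delta)
    qed
    have 2: "c (p, l) = 0" if "l \<in> T" for l
    proof -
      have "?b l = (\<Sum>j\<in>V. if j = p then c (p, l) else 0)"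
        using z 1 that SV by (intro sum.cong) (auto simp: R_def)
      then show ?thesis using b0[of l] that p SV fin by (auto simp: sum.delta)
    qed
    show "\<forall>x\<in>R. c x = 0" using 1 2 by (auto simp: R_def)
  qed
  then have "card R \<le> psd_rank (V \<times> W) (induced_sum \<alpha> M \<beta> N)"
    using fin by (intro null_free_card_le) auto
  then show ?thesis using card by simp
qed

section \<open>Ranks of vector colorings\<close>

lemma gram_coords:
  assumes "\<And>i. i \<in> V \<Longrightarrow> p i \<in> carrier_vec d" "i \<in> V" "j \<in> V"
  shows "gram p i j = (\<Sum>m<d. p i $ m * p j $ m)"
  using assms(1)[OF assms(3)] by (simp add: gram_def scalar_prod_def atLeast0LessThan)

text \<open>Kernel vectors of the Gram matrix are the linear relations among the vectors, so
  independent index sets match independent subsets of the image. As \<open>p\<close> need not be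
  injective, an independent subset is pulled back by choosing one index per vector.\<close>

lemma span_dim_eq_psd_rank:
  assumes fI: "finite I" and p: "\<And>i. i \<in> I \<Longrightarrow> p i \<in> carrier_vec d"
  shows "vec_space.span_dim d (p ` I) = psd_rank I (gram p)"
proof -
  interpret vec_space "TYPE(real)" d .
  have null: "null_vector I (gram p) f \<longleftrightarrow> (\<forall>m<d. (\<Sum>i\<in>I. p i $ m * f i) = 0)" for f
    by (rule null_vector_factor(1)[of I "gram p" "\<lambda>m i. p i $ m" d f]) (rule gram_coords[OF p])
  have pV: "p ` I \<subseteq> carrier_vec d" using p by auto
  have lc: "lincomb a (p ` S) $ m = (\<Sum>i\<in>S. p i $ m * a (p i))"
    if "S \<subseteq> I" "inj_on p S" "m < d" for a S m
    using that pV by (subst lincomb_index) (auto simp: sum.reindex mult.commute)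
  have ext: "(\<Sum>i\<in>I. p i $ m * f i) = (\<Sum>i\<in>S. p i $ m * f i)"
    if "S \<subseteq> I" "\<forall>i\<in>I - S. f i = 0" for S f m
    using that fI by (intro sum.mono_neutral_right) auto
  have lcdim: "lincomb a (p ` S) \<in> carrier_vec d" if "S \<subseteq> I" for a S
    using that p by (intro lincomb_closed) auto
  have A: "inj_on p S \<and> lin_indpt (p ` S)" if S: "null_free I (gram p) S" for S
  proof
    have SV: "S \<subseteq> I" using S by (simp add: null_free_def)
    show inj: "inj_on p S"
    proof (rule inj_onI, rule ccontr)
      fix i j assume ij: "i \<in> S" "j \<in> S" "p i = p j" "i \<noteq> j"
      define f where "f k = (if k = i then 1 else 0) - (if k = j then 1 else (0::real))" for k
      have "(\<Sum>k\<in>I. p k $ m * f k) = p i $ m - p j $ m" for m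
      proof -
        have "(\<Sum>k\<in>I. p k $ m * f k) =
            (\<Sum>k\<in>I. if k = i then p i $ m else 0) - (\<Sum>k\<in>I. if k = j then p j $ m else 0)"
          unfolding sum_subtractf[symmetric] by (intro sum.cong) (auto simp: f_def)
        then show ?thesis using ij SV fI by (auto simp: sum.delta)
      qed
      then have "null_vector I (gram p) f" using ij null by simp
      moreover have "\<And>k. k \<in> I - S \<Longrightarrow> f k = 0" using ij by (auto simp: f_def)
      ultimately have "f i = 0" using null_freeD[OF S] ij SV by blast
      then show False using ij by (simp add: f_def)
    qed
    show "lin_indpt (p ` S)"
    proof (rule finite_lin_indpt2)
      show "finite (p ` S)" using SV fI finite_subset by blast
      show "p ` S \<subseteq> carrier_vec d" using SV p by auto
      fix a :: "real vec \<Rightarrow> real" assume a: "lincomb a (p ` S) = 0\<^sub>v d"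
      define f where "f i = (if i \<in> S then a (p i) else 0)" for i
      have "(\<Sum>i\<in>I. p i $ m * f i) = 0" if "m < d" for m
      proof -
        have "(\<Sum>i\<in>I. p i $ m * f i) = (\<Sum>i\<in>S. p i $ m * a (p i))"
          using ext[OF SV, of f m] by (simp add: f_def)
        also have "\<dots> = lincomb a (p ` S) $ m" using lc[OF SV inj that] by simp
        finally show ?thesis using a that by simp
      qed
      then have "null_vector I (gram p) f" using null by simp
      moreover have "f i = 0" if "i \<in> I - S" for i using that by (simp add: f_def)
      ultimately have "f i = 0" if "i \<in> I" for i using null_freeD[OF S] that by blast
      then show "\<forall>v\<in>p ` S. a v = 0" using SV by (metis f_def imageE subsetD)
    qed
  qed
  have B: "card U \<le> psd_rank I (gram p)" if U: "U \<subseteq> p ` I" "lin_indpt U" for U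
  proof -
    from U(1) obtain S where S: "S \<subseteq> I" "inj_on p S" "U = p ` S"
      by (auto simp: subset_image_inj)
    have "null_free I (gram p) S"
      unfolding null_free_def
    proof (intro conjI allI impI S(1) ballI, rule ccontr)
      fix f i assume f: "null_vector I (gram p) f" "\<forall>i\<in>I - S. f i = 0" and i: "i \<in> S" "f i \<noteq> 0"
      define a where "a v = f (inv_into S p v)" for v
      have af: "a (p i) = f i" if "i \<in> S" for i using that S by (simp add: a_def)
      have "lincomb a U = 0\<^sub>v d"
      proof (rule eq_vecI)
        show "dim_vec (lincomb a U) = dim_vec (0\<^sub>v d)" using lcdim[OF S(1), of a] S(3) by auto
        fix m assume "m < dim_vec (0\<^sub>v d :: real vec)"
        then have m: "m < d" by simp
        have "lincomb a U $ m = (\<Sum>i\<in>S. p i $ m * f i)"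
          using lc[OF S(1,2) m] af S(3) by simp
        also have "\<dots> = 0" using ext[OF S(1) f(2)] f(1) null m by simp
        finally show "lincomb a U $ m = 0\<^sub>v d $ m" using m by simp
      qed
      moreover have "finite U" using S fI finite_subset by blast
      ultimately have "lin_dep U"
        using i af[OF i(1)] S(3) by (intro lin_dep_crit[where A = U and a = a and v = "p i"]) auto
      then show False using U by simp
    qed
    then have "card S \<le> psd_rank I (gram p)" using null_free_card_le fI by blast
    then show ?thesis using S by (simp add: card_image)
  qed
  obtain S where S: "null_free I (gram p) S" "card S = psd_rank I (gram p)"
    using psd_rank_attained[OF fI] .
  have SV: "S \<subseteq> I" using S by (simp add: null_free_def)
  have cS: "card (p ` S) = psd_rank I (gram p)" using A[OF S(1)] S(2) by (simp add: card_image)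
  \<comment> \<open>\<open>dim_span\<close> asks for maximality under inclusion, which the largest
    cardinality provides.\<close>
  have "maximal (p ` S) (\<lambda>T. T \<subseteq> p ` I \<and> lin_indpt T)"
    unfolding maximal_def
  proof (intro conjI allI impI)
    fix T assume T: "p ` S \<subseteq> T \<and> T \<subseteq> p ` I \<and> lin_indpt T"
    then have "card T \<le> card (p ` S)" using B cS by simp
    moreover have "finite T" using T fI finite_subset by blast
    ultimately show "T = p ` S" using T by (metis card_seteq)
  qed (use SV A[OF S(1)] in auto)
  then have "vectorspace.dim class_ring (span_vs (p ` I)) = card (p ` S)"
    using pV fI by (intro dim_span) auto
  then show ?thesis by (simp add: span_dim_def cS)
qed

section \<open>Duality for vector colorings\<close>

text \<open>A vector coloring up to identification: the ambient dimension disappears, and for fixed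
  \<open>t\<close> the colorings form a convex set.\<close>

definition gram_coloring ::
    "'a set \<Rightarrow> ('a \<times> 'a) set \<Rightarrow> real \<Rightarrow> ('a \<Rightarrow> 'a \<Rightarrow> real) \<Rightarrow> bool" where
  "gram_coloring V E t X \<longleftrightarrow>
     1 \<le> t \<and> psd V X \<and> (\<forall>i\<in>V. X i i = t - 1) \<and> (\<forall>i j. (i, j) \<in> E \<longrightarrow> X i j \<le> -1)"

text \<open>A feasible point, of value at least \<open>t\<close>, of the dual semidefinite program;
  that program defines Schrijver's variant of the Lovasz theta number of the complement.\<close>

definition dual_certificate ::
    "'a set \<Rightarrow> ('a \<times> 'a) set \<Rightarrow> real \<Rightarrow> ('a \<Rightarrow> 'a \<Rightarrow> real) \<Rightarrow> bool" where
  "dual_certificate V E t B \<longleftrightarrow>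
     psd V B \<and> (\<forall>i\<in>V. \<forall>j\<in>V. 0 \<le> B i j) \<and>
     (\<forall>i\<in>V. \<forall>j\<in>V. i \<noteq> j \<longrightarrow> (i, j) \<notin> E \<longrightarrow> B i j = 0) \<and>
     (\<Sum>i\<in>V. B i i) = 1 \<and> t \<le> (\<Sum>i\<in>V. \<Sum>j\<in>V. B i j)"

subsection \<open>Weak duality and complementary slackness\<close>

lemma psd_product_factor:
  fixes u :: "nat \<Rightarrow> 'a \<Rightarrow> real"
  assumes "\<And>i j. i \<in> V \<Longrightarrow> j \<in> V \<Longrightarrow> B i j = (\<Sum>m<d. u m i * u m j)"
  shows "(\<Sum>i\<in>V. \<Sum>j\<in>V. B i j * X i j) = (\<Sum>m<d. quad_form V X (u m))"
proof -
  have "(\<Sum>i\<in>V. \<Sum>j\<in>V. B i j * X i j) = (\<Sum>i\<in>V. \<Sum>j\<in>V. \<Sum>m<d. u m i * u m j * X i j)"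
    using assms by (intro sum.cong refl) (simp add: sum_distrib_right)
  then show ?thesis by (simp add: quad_form_def sum.swap[of _ "{..<d}" V])
qed

lemma psd_product_nonneg:
  assumes "finite V" "psd V B" "psd V X"
  shows "0 \<le> (\<Sum>i\<in>V. \<Sum>j\<in>V. B i j * X i j)"
proof -
  from psd_factor_exists[OF assms(1,2)] obtain d and u :: "nat \<Rightarrow> 'a \<Rightarrow> real"
    where u: "\<forall>i\<in>V. \<forall>j\<in>V. B i j = (\<Sum>m<d. u m i * u m j)" by blast
  then have "(\<Sum>i\<in>V. \<Sum>j\<in>V. B i j * X i j) = (\<Sum>m<d. quad_form V X (u m))"
    by (intro psd_product_factor) auto
  then show ?thesis using psd_quad[OF assms(3)] by (simp add: sum_nonneg)
qed

text \<open>The inner product is a sum of nonnegative forms \<open>quad_form V X (u m)\<close>, so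
  each factor \<open>u m\<close> is a kernel vector of \<open>X\<close>, and the columns of
  \<open>B\<close> are combinations of the factors.\<close>

lemma psd_product_zero:
  assumes "finite V" "psd V B" "psd V X" "(\<Sum>i\<in>V. \<Sum>j\<in>V. B i j * X i j) = 0" "k \<in> V"
  shows "null_vector V X (\<lambda>j. B j k)"
proof -
  from psd_factor_exists[OF assms(1,2)] obtain d and u :: "nat \<Rightarrow> 'a \<Rightarrow> real"
    where u: "\<forall>i\<in>V. \<forall>j\<in>V. B i j = (\<Sum>m<d. u m i * u m j)" by blast
  then have "(\<Sum>m<d. quad_form V X (u m)) = 0"
    using psd_product_factor[of V B u d X] assms(4) by auto
  then have "\<forall>m<d. quad_form V X (u m) = 0"
    using psd_quad[OF assms(3)] by (simp add: sum_nonneg_eq_0_iff Ball_def)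
  then have "null_vector V X (u m)" if "m \<in> {..<d}" for m
    using that null_vector_iff_quad_form[OF assms(1,3)] by auto
  then have "null_vector V X (\<lambda>j. \<Sum>m<d. u m k * u m j)" by (rule null_vector_sum)
  moreover have "null_vector V X (\<lambda>j. B j k) \<longleftrightarrow> null_vector V X (\<lambda>j. \<Sum>m<d. u m k * u m j)"
    using u assms(5) by (intro null_vector_cong refl) (simp add: mult.commute)
  ultimately show ?thesis by simp
qed

text \<open>Edges use the coloring inequality, non-edges the support of \<open>B\<close>, and on the
  diagonal equality holds. Weak duality sums these bounds; complementary slackness needs the single
  gaps.\<close>

lemma certificate_entry_le:
  assumes "dual_certificate V E t B" "gram_coloring V E s X" "i \<in> V" "j \<in> V"
  shows "B i j * X i j \<le> (if i = j then s * B i i else 0) - B i j"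
proof (cases "i = j")
  case True
  then have "X i j = s - 1" using assms by (simp add: gram_coloring_def)
  then show ?thesis using True by (simp add: right_diff_distrib mult.commute)
next
  case False
  show ?thesis
  proof (cases "(i, j) \<in> E")
    case True
    then have "B i j * X i j \<le> B i j * (-1)"
      using assms by (intro mult_left_mono) (auto simp: gram_coloring_def dual_certificate_def)
    then show ?thesis using False by simp
  next
    case nE: False
    then have "B i j = 0" using assms(1,3,4) False by (auto simp: dual_certificate_def)
    then show ?thesis using False by simp
  qed
qed

lemma sum_diagonal:
  assumes "finite V"
  shows "(\<Sum>i\<in>V. \<Sum>j\<in>V. if i = j then g i else 0) = (\<Sum>i\<in>V. g i)"
  using assms by (intro sum.cong refl) (simp add: sum.delta)

lemma weak_duality:
  assumes "finite V" "dual_certificate V E t B" "gram_coloring V E s X"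
  shows "t \<le> s" and "(\<Sum>i\<in>V. \<Sum>j\<in>V. B i j * X i j) \<le> s - (\<Sum>i\<in>V. \<Sum>j\<in>V. B i j)"
proof -
  have "(\<Sum>i\<in>V. \<Sum>j\<in>V. B i j * X i j) \<le>
      (\<Sum>i\<in>V. \<Sum>j\<in>V. (if i = j then s * B i i else 0) - B i j)"
    by (intro sum_mono certificate_entry_le[OF assms(2,3)])
  also have "\<dots> = s * (\<Sum>i\<in>V. B i i) - (\<Sum>i\<in>V. \<Sum>j\<in>V. B i j)"
    using assms(1) by (simp add: sum_subtractf sum_diagonal sum_distrib_left)
  finally show 1: "(\<Sum>i\<in>V. \<Sum>j\<in>V. B i j * X i j) \<le> s - (\<Sum>i\<in>V. \<Sum>j\<in>V. B i j)"
    using assms(2) by (simp add: dual_certificate_def)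
  have "0 \<le> (\<Sum>i\<in>V. \<Sum>j\<in>V. B i j * X i j)"
    using assms by (intro psd_product_nonneg) (auto simp: gram_coloring_def dual_certificate_def)
  then show "t \<le> s" using 1 assms(2) by (simp add: dual_certificate_def)
qed

text \<open>Equal values make weak duality tight: the inner product of \<open>B\<close> and
  \<open>X\<close> is 0, so the columns of \<open>B\<close> lie in the kernel of \<open>X\<close>,
  and the nonnegative entrywise gaps have total 0. Each row of gaps then sums to 0, which gives the
  row sums of \<open>B\<close>.\<close>

lemma complementary_slackness:
  assumes fin: "finite V" and B: "dual_certificate V E t B" and X: "gram_coloring V E t X"
  shows "i \<in> V \<Longrightarrow> (\<Sum>j\<in>V. B i j) = t * B i i"
    and "null_vector V X (\<lambda>i. B i i)"
proof -
  have psd: "psd V B" "psd V X" using B X by (auto simp: gram_coloring_def dual_certificate_def)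
  have t: "1 \<le> t" using X by (simp add: gram_coloring_def)
  have le: "(\<Sum>i\<in>V. \<Sum>j\<in>V. B i j * X i j) \<le> t - (\<Sum>i\<in>V. \<Sum>j\<in>V. B i j)"
    by (rule weak_duality(2)[OF fin B X])
  moreover have "0 \<le> (\<Sum>i\<in>V. \<Sum>j\<in>V. B i j * X i j)" by (rule psd_product_nonneg[OF fin psd])
  moreover have "t \<le> (\<Sum>i\<in>V. \<Sum>j\<in>V. B i j)" using B by (simp add: dual_certificate_def)
  ultimately have z: "(\<Sum>i\<in>V. \<Sum>j\<in>V. B i j * X i j) = 0"
    and tot: "(\<Sum>i\<in>V. \<Sum>j\<in>V. B i j) = t" by auto
  define gap where "gap i j = (if i = j then t * B i i else 0) - B i j - B i j * X i j" for i j
  have gap: "0 \<le> gap i j" if "i \<in> V" "j \<in> V" for i j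
    using certificate_entry_le[OF B X that] by (simp add: gap_def)
  have "(\<Sum>i\<in>V. \<Sum>j\<in>V. gap i j) = t * (\<Sum>i\<in>V. B i i) - t - 0"
    unfolding gap_def sum_subtractf z tot sum_diagonal[OF fin] by (simp add: sum_distrib_left)
  also have "\<dots> = 0" using B by (simp add: dual_certificate_def)
  finally have "(\<Sum>i\<in>V. \<Sum>j\<in>V. gap i j) = 0" .
  then have gap0: "(\<Sum>j\<in>V. gap i j) = 0" if "i \<in> V" for i
    using that gap fin by (subst (asm) sum_nonneg_eq_0_iff) (auto intro: sum_nonneg)
  have null: "null_vector V X (\<lambda>j. B j k)" if "k \<in> V" for k
    by (rule psd_product_zero[OF fin psd z that])
  have row: "(\<Sum>j\<in>V. B i j) = t * B i i" if i: "i \<in> V" for i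
  proof -
    \<comment> \<open>The entry at \<open>(i, i)\<close> of the matrix product of \<open>X\<close>
      and \<open>B\<close>, which is 0.\<close>
    have "(\<Sum>j\<in>V. B i j * X i j) = (\<Sum>j\<in>V. X i j * B j i)"
      using psd_sym[OF psd(1)] i by (intro sum.cong) (auto simp: mult.commute)
    also have "\<dots> = 0" using null[OF i] i by (simp add: null_vector_def)
    finally have "(\<Sum>j\<in>V. B i j * X i j) = 0" .
    then show ?thesis using gap0[OF i] i fin by (simp add: gap_def sum_subtractf)
  qed
  then show "i \<in> V \<Longrightarrow> (\<Sum>j\<in>V. B i j) = t * B i i" .
  \<comment> \<open>By the row sums, the diagonal of \<open>B\<close> is the sum of its columns
    divided by \<open>t\<close>.\<close>
  have "null_vector V X (\<lambda>j. \<Sum>k\<in>V. 1 / t * B j k)" by (intro null_vector_sum null)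
  moreover have "(\<Sum>k\<in>V. 1 / t * B j k) = B j j" if "j \<in> V" for j
    using row[OF that] t by (simp add: sum_divide_distrib[symmetric])
  then have "null_vector V X (\<lambda>j. \<Sum>k\<in>V. 1 / t * B j k) \<longleftrightarrow> null_vector V X (\<lambda>j. B j j)"
    by (intro null_vector_cong) auto
  ultimately show "null_vector V X (\<lambda>i. B i i)" by simp
qed

subsection \<open>Compactness of bounded sets of matrices\<close>

lemma compact_PiE_UNIV:
  fixes S :: "'i \<Rightarrow> 'b::topological_space set"
  assumes "\<And>i. compact (S i)"
  shows "compact (PiE UNIV S)"
  using assms compactin_PiE[of "\<lambda>_. euclidean" UNIV S]
  by (simp add: euclidean_product_topology)

text \<open>Matrices are total functions on a possibly infinite index type, so compactness comes
  from Tychonoff's theorem in the product topology.\<close>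

lemma compact_box: "compact {X :: 'a \<Rightarrow> 'b \<Rightarrow> real. \<forall>i j. \<bar>X i j\<bar> \<le> R}"
proof -
  have "{X :: 'a \<Rightarrow> 'b \<Rightarrow> real. \<forall>i j. \<bar>X i j\<bar> \<le> R} = PiE UNIV (\<lambda>_. PiE UNIV (\<lambda>_. {-R..R}))"
    by (auto simp: PiE_def Pi_def abs_le_iff minus_le_iff)
  then show ?thesis by (simp add: compact_PiE_UNIV)
qed

lemma continuous_on_entry: "continuous_on S (\<lambda>X :: 'a \<Rightarrow> 'b \<Rightarrow> real. X i j)"
proof -
  have "continuous_on S (\<lambda>X :: 'a \<Rightarrow> 'b \<Rightarrow> real. X i)"
    by (rule continuous_on_product_then_coordinatewise[where f = "\<lambda>X. X"]) (rule continuous_on_id)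
  then show ?thesis
    by (rule continuous_on_product_then_coordinatewise[where f = "\<lambda>X. X i"])
qed

lemma closed_psd: "closed {X. psd V X}"
proof -
  have "{X. psd V X} = (\<Inter>i\<in>V. \<Inter>j\<in>V. {X. X i j = X j i}) \<inter> (\<Inter>f. {X. 0 \<le> quad_form V X f})"
    by (auto simp: psd_def)
  moreover have "closed {X :: 'a \<Rightarrow> 'a \<Rightarrow> real. X i j = X j i}" for i j
    by (intro closed_Collect_eq continuous_on_entry)
  moreover have "closed {X. 0 \<le> quad_form V X f}" for f
    unfolding quad_form_def by (intro closed_Collect_le continuous_intros continuous_on_entry)
  ultimately show ?thesis by (auto intro!: closed_Int closed_INT)
qed

text \<open>Entries off \<open>V\<close> are arbitrary; setting them to 0 puts a matrix into a
  compact box.\<close>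

definition restrict_to :: "'a set \<Rightarrow> ('a \<Rightarrow> 'a \<Rightarrow> real) \<Rightarrow> 'a \<Rightarrow> 'a \<Rightarrow> real" where
  "restrict_to V X i j = (if i \<in> V \<and> j \<in> V then X i j else 0)"

lemma restrict_to_simp [simp]: "i \<in> V \<Longrightarrow> j \<in> V \<Longrightarrow> restrict_to V X i j = X i j"
  by (simp add: restrict_to_def)

lemma psd_restrict_to [simp]: "psd V (restrict_to V X) = psd V X"
  by (rule psd_cong) simp

lemma restrict_to_bound:
  assumes "finite V" "psd V X" "\<And>i. i \<in> V \<Longrightarrow> X i i \<le> R" "0 \<le> R"
  shows "\<bar>restrict_to V X i j\<bar> \<le> R"
proof (cases "i \<in> V \<and> j \<in> V")
  case True
  then show ?thesis
    using psd_offdiag_bound[OF assms(1,2), of i j] assms(3)[of i] assms(3)[of j] by simp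
qed (use assms in \<open>auto simp: restrict_to_def\<close>)

text \<open>A diagonal below the prescribed value can be raised to it, so the diagonal equations may
  be relaxed to upper bounds.\<close>

lemma psd_add_diagonal:
  assumes "finite V" "psd V X" "\<And>i. i \<in> V \<Longrightarrow> 0 \<le> g i"
  shows "psd V (\<lambda>i j. X i j + (if i = j then g i else 0))"
proof (rule psd_add[OF assms(2)])
  have "quad_form V (\<lambda>i j. if i = j then g i else 0) f = (\<Sum>i\<in>V. f i * f i * g i)" for f
    using sum_diagonal[OF assms(1), of "\<lambda>i. f i * f i * g i"]
    by (simp add: quad_form_def if_distrib cong: if_cong)
  then show "psd V (\<lambda>i j. if i = j then g i else 0)"
    using assms(3) by (auto simp: psd_def intro!: sum_nonneg)
qed

subsection \<open>Attainment and strong duality\<close>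

text \<open>For the weighted Laplacian of \<open>B\<close> the form is half the sum of the terms
  \<open>B i j * (f i - f j)^2\<close>.\<close>

lemma psd_laplacian:
  assumes fin: "finite V" and sym: "\<And>i j. i \<in> V \<Longrightarrow> j \<in> V \<Longrightarrow> B i j = B j i"
    and nn: "\<And>i j. i \<in> V \<Longrightarrow> j \<in> V \<Longrightarrow> 0 \<le> B i j"
    and row: "\<And>i. i \<in> V \<Longrightarrow> (\<Sum>j\<in>V. B i j) = r i"
  shows "psd V (\<lambda>i j. (if i = j then r i else 0) - B i j)"
proof -
  have "quad_form V (\<lambda>i j. (if i = j then r i else 0) - B i j) f =
      (\<Sum>i\<in>V. \<Sum>j\<in>V. B i j * (f i - f j)\<^sup>2) / 2" for f
  proof -
    have d: "(\<Sum>i\<in>V. \<Sum>j\<in>V. B i j * (f i)\<^sup>2) = (\<Sum>i\<in>V. r i * (f i)\<^sup>2)"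
      using row by (intro sum.cong) (auto simp: sum_distrib_right[symmetric])
    have d': "(\<Sum>i\<in>V. \<Sum>j\<in>V. B i j * (f j)\<^sup>2) = (\<Sum>i\<in>V. r i * (f i)\<^sup>2)"
      unfolding d[symmetric] by (subst sum.swap) (auto intro!: sum.cong simp: sym)
    have "(\<Sum>i\<in>V. \<Sum>j\<in>V. B i j * (f i - f j)\<^sup>2) =
        (\<Sum>i\<in>V. \<Sum>j\<in>V. B i j * (f i)\<^sup>2) + (\<Sum>i\<in>V. \<Sum>j\<in>V. B i j * (f j)\<^sup>2)
        - 2 * (\<Sum>i\<in>V. \<Sum>j\<in>V. f i * f j * B i j)"
      by (simp add: power2_diff algebra_simps sum.distrib sum_subtractf sum_distrib_left)
    moreover have "quad_form V (\<lambda>i j. (if i = j then r i else 0) - B i j) f =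
        (\<Sum>i\<in>V. \<Sum>j\<in>V. (if i = j then r i * (f i)\<^sup>2 else 0) - f i * f j * B i j)"
      unfolding quad_form_def by (intro sum.cong refl) (auto simp: algebra_simps power2_eq_square)
    ultimately show ?thesis unfolding d d' using fin by (simp add: sum_subtractf sum_diagonal)
  qed
  moreover have "0 \<le> (\<Sum>i\<in>V. \<Sum>j\<in>V. B i j * (f i - f j)\<^sup>2)" for f :: "'a \<Rightarrow> real"
    using nn by (intro sum_nonneg mult_nonneg_nonneg) auto
  ultimately have "0 \<le> quad_form V (\<lambda>i j. (if i = j then r i else 0) - B i j) f" for f
    by (simp only: zero_le_divide_iff) simp
  then show ?thesis using sym by (auto simp: psd_def)
qed

text \<open>The Laplacian of unit weights, which is the Gram matrix of a regular simplex. On a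
  nonempty \<open>V\<close> it colors every loopless graph with value \<open>card V\<close>.\<close>

lemma simplex_gram_psd:
  assumes "finite V"
  shows "psd V (\<lambda>i j. (if i = j then real (card V) else 0) - 1)"
  using assms by (intro psd_laplacian[where B = "\<lambda>_ _. 1"]) auto

text \<open>The value is read off the diagonal, so an entry \<open>X v v\<close> is minimised over
  psd matrices of constant diagonal. The bound on the entries is harmless, since the simplex already
  satisfies it.\<close>

lemma minimal_gram_coloring_exists:
  assumes fin: "finite V" and E: "E \<subseteq> V \<times> V" "\<And>i. (i, i) \<notin> E"
  shows "\<exists>t X. gram_coloring V E t X \<and> (\<forall>s Y. gram_coloring V E s Y \<longrightarrow> t \<le> s)"
proof (cases "V = {}")
  case True
  then have "gram_coloring V E 1 (\<lambda>_ _. 0)" using E by (auto simp: gram_coloring_def psd_def quad_form_def)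
  then show ?thesis by (metis gram_coloring_def)
next
  case False
  then obtain v where v: "v \<in> V" by auto
  define n where "n = real (card V)"
  have n1: "1 \<le> n" using fin v by (simp add: n_def Suc_le_eq card_gt_0_iff) auto
  define K where "K = {X. \<forall>i j. \<bar>X i j\<bar> \<le> n} \<inter> ({X. psd V X} \<inter>
    ((\<Inter>i\<in>V. {X. X i i = X v v}) \<inter> (\<Inter>e\<in>E. {X. X (fst e) (snd e) \<le> -1})))"
  have "compact K" unfolding K_def
    by (intro compact_Int_closed compact_box closed_Int closed_psd closed_INT ballI closed_Collect_eq
        closed_Collect_le continuous_on_entry continuous_on_const)
  have KI: "restrict_to V X \<in> K"
    if "gram_coloring V E s X" "s - 1 \<le> n" for s X
  proof -
    have X: "psd V X" "\<And>i. i \<in> V \<Longrightarrow> X i i = s - 1" "\<And>i j. (i, j) \<in> E \<Longrightarrow> X i j \<le> -1"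
      using that by (auto simp: gram_coloring_def)
    have "\<bar>restrict_to V X i j\<bar> \<le> n" for i j
      using X that n1 by (intro restrict_to_bound[OF fin]) auto
    moreover have "restrict_to V X i j \<le> -1" if "(i, j) \<in> E" for i j
      using that E X(3) by (auto simp: restrict_to_def)
    ultimately show ?thesis using X v by (auto simp: K_def)
  qed
  have "gram_coloring V E n (\<lambda>i j. (if i = j then real (card V) else 0) - 1)"
    using n1 simplex_gram_psd[OF fin] E by (auto simp: gram_coloring_def n_def)
  then have "K \<noteq> {}" using KI by fastforce
  then obtain X where X: "X \<in> K" "\<And>Y. Y \<in> K \<Longrightarrow> X v v \<le> Y v v"
    using continuous_attains_inf[OF \<open>compact K\<close> _ continuous_on_entry[of K v v]] by auto
  have XK: "psd V X" "\<And>i. i \<in> V \<Longrightarrow> X i i = X v v" "\<And>i j. (i, j) \<in> E \<Longrightarrow> X i j \<le> -1" "X v v \<le> n"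
    using X(1) by (force simp: K_def abs_le_iff)+
  have "gram_coloring V E (X v v + 1) X"
    using XK psd_diag_nonneg[OF XK(1) fin v] by (auto simp: gram_coloring_def)
  moreover have "X v v + 1 \<le> s" if Y: "gram_coloring V E s Y" for s Y
  \<comment> \<open>A coloring too large for the box has \<open>s - 1 > n\<close>, whereas the
    minimiser has diagonal at most \<open>n\<close>.\<close>
  proof (cases "s - 1 \<le> n")
    case True
    have "X v v \<le> restrict_to V Y v v" by (rule X(2)[OF KI[OF Y True]])
    then show ?thesis using v Y by (simp add: gram_coloring_def)
  qed (use XK(4) in simp)
  ultimately show ?thesis by blast
qed

text \<open>A quadratic upper model of the squared positive part, with slope
  \<open>2 * max 0 x\<close> at \<open>x\<close>; it stands in for differentiation in the
  first-order condition.\<close>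

lemma positive_part_square_bound:
  fixes x y :: real
  shows "(max 0 (x + y))\<^sup>2 \<le> (max 0 x)\<^sup>2 + 2 * y * max 0 x + y\<^sup>2"
proof (cases "0 \<le> x")
  case True
  have "(max 0 (x + y))\<^sup>2 \<le> (x + y)\<^sup>2" by (rule abs_le_square_iff[THEN iffD1]) simp
  then show ?thesis using True by (simp add: power2_sum max_def algebra_simps)
next
  case False
  have "(max 0 (x + y))\<^sup>2 \<le> y\<^sup>2" using False by (intro abs_le_square_iff[THEN iffD1]) simp
  then show ?thesis using False by simp
qed

lemma nonneg_of_quadratic_bound:
  fixes l q :: real
  assumes "\<And>\<epsilon>. 0 < \<epsilon> \<Longrightarrow> \<epsilon> \<le> 1 \<Longrightarrow> 0 \<le> 2 * \<epsilon> * l + \<epsilon>\<^sup>2 * q" and "0 \<le> q"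
  shows "0 \<le> l"
proof (rule ccontr)
  assume "\<not> 0 \<le> l"
  then have l: "l < 0" by simp
  \<comment> \<open>Small enough that \<open>e * q \<le> - l\<close>, hence
    \<open>2 * l + e * q \<le> l < 0\<close>; the denominator is positive even for
    \<open>q = 0\<close>.\<close>
  define e where "e = min 1 (- l / (q + 1))"
  have e: "0 < e" "e \<le> 1" using l assms(2) by (auto simp: e_def divide_less_0_iff)
  have "0 \<le> e * (2 * l + e * q)" using assms(1)[OF e] by (simp add: power2_eq_square algebra_simps)
  then have "0 \<le> 2 * l + e * q" using e by (simp add: zero_le_mult_iff)
  moreover have "e * q \<le> - l / (q + 1) * (q + 1)"
    using assms(2) l e by (intro mult_mono) (auto simp: e_def)
  then have "e * q \<le> - l" using assms(2) by simp
  ultimately show False using l by simp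
qed

text \<open>The certificate is the residual of a psd matrix minimising the squared violation of the
  coloring constraints; first-order optimality makes it psd and orthogonal to that matrix.\<close>

lemma dual_certificate_below:
  assumes fin: "finite V" and E: "E \<subseteq> V \<times> V" "\<And>i. (i, i) \<notin> E" "\<And>i j. (i, j) \<in> E \<Longrightarrow> (j, i) \<in> E"
    and s: "1 \<le> s" and none: "\<And>X. \<not> gram_coloring V E s X"
  shows "\<exists>B. dual_certificate V E s B"
proof -
  define I where "I = {(i, j). i \<in> V \<and> j \<in> V \<and> (i = j \<or> (i, j) \<in> E)}"
  have I: "finite I" "I \<subseteq> V \<times> V"
    using fin by (auto simp: I_def intro: finite_subset[of _ "V \<times> V"])
  \<comment> \<open>All constraints become upper bounds, those on the diagonal included; missing
    diagonal is added at the end.\<close>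
  define c where "c e = (if fst e = snd e then s - 1 else -1)" for e :: "'a \<times> 'a"
  define F where "F X = (\<Sum>e\<in>I. (max 0 (X (fst e) (snd e) - c e))\<^sup>2)" for X :: "'a \<Rightarrow> 'a \<Rightarrow> real"
  \<comment> \<open>A diagonal entry beyond \<open>R\<close> violates its own bound by more than
    \<open>card I + 1\<close>, which costs more than the zero matrix.\<close>
  define R where "R = s + real (card I)"
  define K where "K = {X :: 'a \<Rightarrow> 'a \<Rightarrow> real. \<forall>i j. \<bar>X i j\<bar> \<le> R} \<inter> {X. psd V X}"
  have R0: "0 \<le> R" using s by (simp add: R_def)
  have zeroK: "(\<lambda>_ _. 0) \<in> K" using R0 by (auto simp: K_def psd_def quad_form_def)
  have "F (\<lambda>_ _. 0) \<le> (\<Sum>e\<in>I. 1)"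
    unfolding F_def using s by (intro sum_mono) (auto simp: c_def max_def)
  then have F0: "F (\<lambda>_ _. 0) \<le> real (card I)" by simp
  have "compact K" unfolding K_def by (intro compact_Int_closed compact_box closed_psd)
  moreover have "continuous_on K F" unfolding F_def
    by (intro continuous_intros continuous_on_entry)
  ultimately obtain X where X: "X \<in> K" "\<And>Y. Y \<in> K \<Longrightarrow> F X \<le> F Y"
    using continuous_attains_inf[of K F] zeroK by blast
  have pX: "psd V X" using X by (simp add: K_def)
  have FX: "F X \<le> F Y" if Y: "psd V Y" for Y
  proof (cases "\<forall>i\<in>V. Y i i \<le> R")
    case True
    have "\<bar>restrict_to V Y i j\<bar> \<le> R" for i j
      using True by (intro restrict_to_bound[OF fin Y _ R0]) auto
    then have "restrict_to V Y \<in> K" using Y by (simp add: K_def)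
    moreover have "F (restrict_to V Y) = F Y"
      unfolding F_def using I by (intro sum.cong refl) (auto simp: restrict_to_def)
    ultimately show ?thesis using X(2) by metis
  next
    case False
    then obtain i where i: "i \<in> V" "R < Y i i" by auto
    have "F X \<le> real (card I)" using X(2)[OF zeroK] F0 by simp
    also have "\<dots> \<le> (real (card I) + 1)\<^sup>2" by (simp add: power2_eq_square algebra_simps)
    also have "\<dots> \<le> (max 0 (Y i i - c (i, i)))\<^sup>2"
      using i(2) by (intro power_mono) (auto simp: c_def R_def)
    also have "\<dots> \<le> F Y"
      unfolding F_def using I i(1)
      by (intro member_le_sum[where i = "(i, i)" and f = "\<lambda>e. (max 0 (Y (fst e) (snd e) - c e))\<^sup>2", simplified])
        (auto simp: I_def)
    finally show ?thesis .
  qed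
  define w where "w e = max 0 (X (fst e) (snd e) - c e)" for e
  \<comment> \<open>The admissible directions are those along which \<open>X\<close> stays psd.
    Rank-one directions make the residual psd, and the direction \<open>- X\<close> bounds its inner
    product with \<open>X\<close>.\<close>
  have first_order: "0 \<le> (\<Sum>e\<in>I. w e * Z (fst e) (snd e))"
    if Z: "\<And>\<epsilon>. 0 < \<epsilon> \<Longrightarrow> \<epsilon> \<le> 1 \<Longrightarrow> psd V (\<lambda>i j. X i j + \<epsilon> * Z i j)" for Z
  proof (rule nonneg_of_quadratic_bound[where q = "\<Sum>e\<in>I. (Z (fst e) (snd e))\<^sup>2"])
    fix \<epsilon> :: real assume e: "0 < \<epsilon>" "\<epsilon> \<le> 1"
    have "F (\<lambda>i j. X i j + \<epsilon> * Z i j) \<le> (\<Sum>e\<in>I. (max 0 (X (fst e) (snd e) - c e))\<^sup>2 +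
        2 * (\<epsilon> * Z (fst e) (snd e)) * w e + (\<epsilon> * Z (fst e) (snd e))\<^sup>2)"
      unfolding F_def w_def
    proof (rule sum_mono)
      fix e
      show "(max 0 (X (fst e) (snd e) + \<epsilon> * Z (fst e) (snd e) - c e))\<^sup>2 \<le>
        (max 0 (X (fst e) (snd e) - c e))\<^sup>2 +
        2 * (\<epsilon> * Z (fst e) (snd e)) * max 0 (X (fst e) (snd e) - c e) + (\<epsilon> * Z (fst e) (snd e))\<^sup>2"
        using positive_part_square_bound[of "X (fst e) (snd e) - c e" "\<epsilon> * Z (fst e) (snd e)"]
        by (simp add: add_diff_eq diff_add_eq)
    qed
    also have "\<dots> = F X + 2 * \<epsilon> * (\<Sum>e\<in>I. w e * Z (fst e) (snd e)) + \<epsilon>\<^sup>2 * (\<Sum>e\<in>I. (Z (fst e) (snd e))\<^sup>2)"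
      by (simp add: F_def sum.distrib sum_distrib_left power_mult_distrib mult_ac)
    finally show "0 \<le> 2 * \<epsilon> * (\<Sum>e\<in>I. w e * Z (fst e) (snd e)) + \<epsilon>\<^sup>2 * (\<Sum>e\<in>I. (Z (fst e) (snd e))\<^sup>2)"
      using FX[OF Z[OF e]] by simp
  qed (simp add: sum_nonneg)
  define B where "B i j = (if (i, j) \<in> I then w (i, j) else 0)" for i j
  have sumB: "(\<Sum>i\<in>V. \<Sum>j\<in>V. B i j * Z i j) = (\<Sum>e\<in>I. w e * Z (fst e) (snd e))" for Z
  proof -
    have "(\<Sum>i\<in>V. \<Sum>j\<in>V. B i j * Z i j) = (\<Sum>e\<in>V \<times> V. if e \<in> I then w e * Z (fst e) (snd e) else 0)"
      unfolding sum.cartesian_product by (intro sum.cong refl) (auto simp: B_def)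
    then show ?thesis
      using I fin by (simp add: sum.If_cases Int_absorb1)
  qed
  have Bsym: "B i j = B j i" if "i \<in> V" "j \<in> V" for i j
    using that psd_sym[OF pX that] E(3) by (auto simp: B_def I_def w_def c_def)
  have pB: "psd V B"
    unfolding psd_def
  proof (intro conjI ballI allI)
    fix f
    have "psd V (\<lambda>i j. f i * f j)" using psd_factor[where V = V and d = 1 and u = "\<lambda>_. f"] by simp
    then have "0 \<le> (\<Sum>e\<in>I. w e * (f (fst e) * f (snd e)))"
      using pX by (intro first_order psd_add psd_scale) auto
    then show "0 \<le> quad_form V B f"
      using sumB[of "\<lambda>i j. f i * f j"] by (simp add: quad_form_def mult_ac)
  qed (rule Bsym)
  have "psd V (\<lambda>i j. X i j + \<epsilon> * (- X i j))" if "0 < \<epsilon>" "\<epsilon> \<le> 1" for \<epsilon>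
    using psd_scale[OF pX, of "1 - \<epsilon>"] that by (simp add: left_diff_distrib)
  from first_order[OF this] have BX: "(\<Sum>e\<in>I. w e * X (fst e) (snd e)) \<le> 0"
    by (simp add: sum_negf)
  \<comment> \<open>The residual is positive only at violated constraints, where
    \<open>c e < X (fst e) (snd e)\<close>.\<close>
  have "w e * c e \<le> w e * X (fst e) (snd e)" for e
    by (auto simp: w_def max_def intro: mult_left_mono)
  then have "(\<Sum>e\<in>I. w e * c e) \<le> (\<Sum>e\<in>I. w e * X (fst e) (snd e))" by (rule sum_mono)
  with BX have "(\<Sum>e\<in>I. w e * c e) \<le> 0" by simp
  then have "(\<Sum>i\<in>V. \<Sum>j\<in>V. B i j * c (i, j)) \<le> 0" using sumB[of "\<lambda>i j. c (i, j)"] by simp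
  moreover have "(\<Sum>i\<in>V. \<Sum>j\<in>V. B i j * c (i, j)) = (\<Sum>i\<in>V. \<Sum>j\<in>V. (if i = j then s * B i i else 0) - B i j)"
    by (intro sum.cong refl) (auto simp: c_def algebra_simps)
  ultimately have tot: "s * (\<Sum>i\<in>V. B i i) \<le> (\<Sum>i\<in>V. \<Sum>j\<in>V. B i j)"
    using fin by (simp add: sum_subtractf sum_diagonal sum_distrib_left)
  have Bnn: "0 \<le> B i j" for i j by (simp add: B_def w_def)
  \<comment> \<open>With trace 0 the psd matrix \<open>B\<close> vanishes on \<open>V\<close>; then
    \<open>X\<close> violates nothing, and raising its diagonal to \<open>s - 1\<close> yields a
    coloring of value \<open>s\<close>.\<close>
  have "(\<Sum>i\<in>V. B i i) \<noteq> 0"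
  proof
    assume z: "(\<Sum>i\<in>V. B i i) = 0"
    have diag: "B i i = 0" if "i \<in> V" for i
      using z Bnn fin that by (subst (asm) sum_nonneg_eq_0_iff) auto
    have B0: "B i j = 0" if "i \<in> V" "j \<in> V" for i j
      by (rule psd_zero_diag[OF fin pB that diag[OF that(1)]])
    have le: "X i j \<le> c (i, j)" if "(i, j) \<in> I" for i j
      using B0[of i j] that I by (auto simp: B_def w_def max_def split: if_splits)
    have "gram_coloring V E s (\<lambda>i j. X i j + (if i = j then s - 1 - X i i else 0))"
      unfolding gram_coloring_def
    proof (intro conjI ballI allI impI)
      show "psd V (\<lambda>i j. X i j + (if i = j then s - 1 - X i i else 0))"
      proof (rule psd_add_diagonal[OF fin pX])
        fix i assume "i \<in> V"
        then show "0 \<le> s - 1 - X i i" using le[of i i] by (simp add: I_def c_def)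
      qed
      fix i j assume ij: "(i, j) \<in> E"
      then have "i \<noteq> j" "(i, j) \<in> I" using E by (auto simp: I_def)
      then show "X i j + (if i = j then s - 1 - X i i else 0) \<le> -1"
        using le[of i j] by (simp add: c_def)
    qed (use s in auto)
    then show False using none by blast
  qed
  moreover have "0 \<le> (\<Sum>i\<in>V. B i i)" using Bnn by (simp add: sum_nonneg)
  ultimately have pos: "0 < (\<Sum>i\<in>V. B i i)" by simp
  define r where "r = 1 / (\<Sum>i\<in>V. B i i)"
  have r: "0 < r" "r * (\<Sum>i\<in>V. B i i) = 1" using pos by (auto simp: r_def)
  have "dual_certificate V E s (\<lambda>i j. r * B i j)"
    unfolding dual_certificate_def
  proof (intro conjI ballI impI)
    show "psd V (\<lambda>i j. r * B i j)" using pB r by (intro psd_scale) auto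
    show "(\<Sum>i\<in>V. r * B i i) = 1" using r by (simp add: sum_distrib_left[symmetric])
    have "s = r * (s * (\<Sum>i\<in>V. B i i))" using r(2) by (simp add: mult.left_commute[of r s])
    also have "\<dots> \<le> r * (\<Sum>i\<in>V. \<Sum>j\<in>V. B i j)"
      using tot r by (intro mult_left_mono) auto
    finally show "s \<le> (\<Sum>i\<in>V. \<Sum>j\<in>V. r * B i j)"
      by (simp add: sum_distrib_left)
    fix i j assume "i \<in> V" "j \<in> V"
    show "0 \<le> r * B i j" using r Bnn by simp
    show "r * B i j = 0" if "i \<noteq> j" "(i, j) \<notin> E" using that by (simp add: B_def I_def)
  qed
  then show ?thesis by blast
qed

text \<open>\<open>dual_certificate_below\<close> serves every \<open>s\<close> with
  \<open>1 \<le> s < t\<close>. Certificates have entries bounded by their trace 1, so compactness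
  yields one of largest entry sum, which is at least every such \<open>s\<close>. At
  \<open>t\<close> itself a coloring may exist, so this value is reached only as a limit.\<close>

lemma strong_duality:
  assumes fin: "finite V" and E: "E \<subseteq> V \<times> V" "\<And>i. (i, i) \<notin> E" "\<And>i j. (i, j) \<in> E \<Longrightarrow> (j, i) \<in> E"
    and t: "1 < t" and min: "\<And>s X. gram_coloring V E s X \<Longrightarrow> t \<le> s"
  shows "\<exists>B. dual_certificate V E t B"
proof -
  define K where "K = {B :: 'a \<Rightarrow> 'a \<Rightarrow> real. \<forall>i j. \<bar>B i j\<bar> \<le> 1} \<inter> ({B. psd V B} \<inter>
    ((\<Inter>i\<in>V. \<Inter>j\<in>V. {B. 0 \<le> B i j}) \<inter>
    ((\<Inter>e\<in>{(i, j). i \<in> V \<and> j \<in> V \<and> i \<noteq> j \<and> (i, j) \<notin> E}. {B. B (fst e) (snd e) = 0}) \<inter>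
    {B. (\<Sum>i\<in>V. B i i) = 1})))"
  let ?tot = "\<lambda>B :: 'a \<Rightarrow> 'a \<Rightarrow> real. \<Sum>i\<in>V. \<Sum>j\<in>V. B i j"
  have "compact K" unfolding K_def
    by (intro compact_Int_closed compact_box closed_Int closed_psd closed_INT ballI closed_Collect_eq
        closed_Collect_le continuous_on_entry continuous_on_const continuous_on_sum)
  have KD: "dual_certificate V E (?tot B) B" if "B \<in> K" for B
    using that by (auto simp: K_def dual_certificate_def)
  have KI: "restrict_to V B \<in> K" "?tot (restrict_to V B) = ?tot B" if B: "dual_certificate V E s B" for s B
  proof -
    have diag: "B i i \<le> 1" if "i \<in> V" for i
    proof -
      have "B i i \<le> (\<Sum>i\<in>V. B i i)" using B fin that by (intro member_le_sum) (auto simp: dual_certificate_def)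
      then show ?thesis using B by (simp add: dual_certificate_def)
    qed
    then have "\<bar>restrict_to V B i j\<bar> \<le> 1" for i j
      using B by (intro restrict_to_bound[OF fin]) (auto simp: dual_certificate_def)
    then show "restrict_to V B \<in> K" using B by (auto simp: K_def dual_certificate_def)
    show "?tot (restrict_to V B) = ?tot B" by (intro sum.cong) auto
  qed
  have ex: "\<exists>B. dual_certificate V E s B" if "1 \<le> s" "s < t" for s
    using min that by (intro dual_certificate_below[OF fin E]) (auto dest!: min)
  then have "K \<noteq> {}" using KI(1) t by fastforce
  moreover have "continuous_on K ?tot" by (intro continuous_on_sum continuous_on_entry)
  ultimately obtain B where B: "B \<in> K" "\<And>C. C \<in> K \<Longrightarrow> ?tot C \<le> ?tot B"
    using continuous_attains_sup[OF \<open>compact K\<close>, of ?tot] by blast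
  have "t \<le> ?tot B"
  proof (rule ccontr)
    assume "\<not> t \<le> ?tot B"
    then obtain s where s: "?tot B < s" "1 < s" "s < t" using t dense[of "max 1 (?tot B)" t] by auto
    obtain C where C: "dual_certificate V E s C" using ex[of s] s by auto
    then have "s \<le> ?tot C" by (simp add: dual_certificate_def)
    also have "\<dots> \<le> ?tot B" using B(2)[OF KI(1)[OF C]] KI(2)[OF C] by simp
    finally show False using s by simp
  qed
  then show ?thesis using KD[OF B(1)] by (auto simp: dual_certificate_def)
qed

section \<open>The certificate of a categorical product\<close>

definition product_arcs :: "('a \<times> 'a) set \<Rightarrow> ('b \<times> 'b) set \<Rightarrow> (('a \<times> 'b) \<times> ('a \<times> 'b)) set" where
  "product_arcs E F = {((i, l), (j, k)) | i l j k. (i, j) \<in> E \<and> (l, k) \<in> F}"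

text \<open>Normalise the diagonals of B and C to the identity: their off-diagonal parts then have
  spectrum in [-1, t - 1], and (t - 1) + xy is a nonnegative combination of
  (t - 1 - x)(t - 1 - y) and (1 + x)(1 + y).\<close>

lemma product_certificate:
  assumes fin: "finite V" "finite W" and t: "1 < t"
    and B: "dual_certificate V E t B" "\<And>i. i \<in> V \<Longrightarrow> (\<Sum>j\<in>V. B i j) = t * B i i"
    and C: "dual_certificate W F t C" "\<And>i. i \<in> W \<Longrightarrow> (\<Sum>j\<in>W. C i j) = t * C i i"
  shows "\<exists>P. dual_certificate (V \<times> W) (product_arcs E F) t P"
proof -
  define L where "L i j = (if i = j then t * B i i else 0) - B i j" for i j
  define M where "M i j = (if i = j then t * C i i else 0) - C i j" for i j
  \<comment> \<open>Normalises the trace: the bracket in \<open>P\<close> has diagonal entries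
    \<open>(t - 1)^2 + (t - 1) = t * (t - 1)\<close> times those of
    \<open>kronecker B C\<close>.\<close>
  define c where "c = 1 / (t * (t - 1))"
  have c: "0 < c" "c * (t * (t - 1)) = 1" using t by (auto simp: c_def)
  \<comment> \<open>At pairs with exactly one equal coordinate, \<open>kronecker L M\<close>
    contributes \<open>- (t - 1)\<close> times the entry of \<open>kronecker B C\<close>; the weight
    \<open>t - 1\<close> cancels it, as it must, since such pairs are not arcs of the
    product.\<close>
  define P where "P x y = c * (1 * kronecker L M x y + (t - 1) * kronecker B C x y)" for x y
  have pB: "psd V B" and pC: "psd W C" using B C by (auto simp: dual_certificate_def)
  have pL: "psd V L" unfolding L_def using B psd_sym[OF pB]
    by (intro psd_laplacian[OF fin(1)]) (auto simp: dual_certificate_def)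
  have pM: "psd W M" unfolding M_def using C psd_sym[OF pC]
    by (intro psd_laplacian[OF fin(2)]) (auto simp: dual_certificate_def)
  have pP: "psd (V \<times> W) P" unfolding P_def
    using t c by (intro psd_scale psd_add psd_kronecker fin pL pM pB pC) auto
  have Pdiag: "P x x = B (fst x) (fst x) * C (snd x) (snd x)" for x
  proof -
    have "P x x = (c * (t * (t - 1))) * (B (fst x) (fst x) * C (snd x) (snd x))"
      by (simp add: P_def L_def M_def kronecker_def algebra_simps)
    then show ?thesis using c by simp
  qed
  have Poff: "P (i, l) (j, k) = (if i \<noteq> j \<and> l \<noteq> k then c * t * B i j * C l k else 0)"
    if "(i, l) \<noteq> (j, k)" for i l j k
    using that by (auto simp: P_def L_def M_def kronecker_def algebra_simps)
  have tot: "(\<Sum>i\<in>V. \<Sum>j\<in>V. X i j) * (\<Sum>l\<in>W. \<Sum>k\<in>W. Y l k) =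
      (\<Sum>x\<in>V \<times> W. \<Sum>y\<in>V \<times> W. kronecker X Y x y)" for X :: "'a \<Rightarrow> 'a \<Rightarrow> real" and Y :: "'b \<Rightarrow> 'b \<Rightarrow> real"
    unfolding sum_Times sum_product by (simp add: kronecker_def sum_product)
  \<comment> \<open>So the total of \<open>P\<close> comes from \<open>kronecker B C\<close>, whose
    entries sum to \<open>t * t\<close>.\<close>
  have "(\<Sum>i\<in>V. \<Sum>j\<in>V. L i j) = 0"
    using B(2) fin by (simp add: L_def sum_subtractf sum.delta')
  moreover have sB: "(\<Sum>i\<in>V. \<Sum>j\<in>V. B i j) = t"
    using B by (simp add: sum_distrib_left[symmetric] dual_certificate_def)
  moreover have sC: "(\<Sum>i\<in>W. \<Sum>j\<in>W. C i j) = t"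
    using C by (simp add: sum_distrib_left[symmetric] dual_certificate_def)
  moreover have "(\<Sum>x\<in>V \<times> W. \<Sum>y\<in>V \<times> W. P x y) =
      c * ((\<Sum>x\<in>V \<times> W. \<Sum>y\<in>V \<times> W. kronecker L M x y) + (t - 1) * (\<Sum>x\<in>V \<times> W. \<Sum>y\<in>V \<times> W. kronecker B C x y))"
    by (simp only: P_def sum.distrib sum_distrib_left[symmetric] mult_1)
  ultimately have "(\<Sum>x\<in>V \<times> W. \<Sum>y\<in>V \<times> W. P x y) = (c * (t * (t - 1))) * t"
    by (simp add: tot[symmetric] mult_ac)
  then have total: "(\<Sum>x\<in>V \<times> W. \<Sum>y\<in>V \<times> W. P x y) = t" using c by simp
  have "(\<Sum>x\<in>V \<times> W. P x x) = (\<Sum>i\<in>V. B i i) * (\<Sum>l\<in>W. C l l)"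
    by (simp add: Pdiag sum_Times sum_product)
  then have tr: "(\<Sum>x\<in>V \<times> W. P x x) = 1" using B C by (simp add: dual_certificate_def)
  have nnB: "0 \<le> B i j" if "i \<in> V" "j \<in> V" for i j using B that by (auto simp: dual_certificate_def)
  have nnC: "0 \<le> C i j" if "i \<in> W" "j \<in> W" for i j using C that by (auto simp: dual_certificate_def)
  have "dual_certificate (V \<times> W) (product_arcs E F) t P"
    unfolding dual_certificate_def
  proof (intro conjI ballI impI pP tr)
    fix x y assume xy: "x \<in> V \<times> W" "y \<in> V \<times> W"
    show "0 \<le> P x y"
    proof (cases "x = y")
      case True
      then show ?thesis using xy nnB nnC by (auto simp: Pdiag)
    next
      case False
      then show ?thesis using xy nnB nnC c t by (cases x; cases y) (auto simp: Poff)
    qed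
    assume "x \<noteq> y" "(x, y) \<notin> product_arcs E F"
    then show "P x y = 0" using xy B(1) C(1)
      by (cases x; cases y) (auto simp: Poff product_arcs_def dual_certificate_def)
  qed (use total in simp)
  then show ?thesis by blast
qed

section \<open>Splitting an optimal coloring of the product\<close>

lemma gram_coloring_induced_sum:
  assumes "finite V" "finite W" "gram_coloring V E t M" "gram_coloring W F t N"
    "0 \<le> \<alpha>" "0 \<le> \<beta>" "\<alpha> + \<beta> = 1"
  shows "gram_coloring (V \<times> W) (product_arcs E F) t (induced_sum \<alpha> M \<beta> N)"
  unfolding gram_coloring_def
proof (intro conjI ballI allI impI)
  show "psd (V \<times> W) (induced_sum \<alpha> M \<beta> N)"
    using assms by (intro psd_induced_sum) (auto simp: gram_coloring_def)
  show "1 \<le> t" using assms by (simp add: gram_coloring_def)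
  have b: "\<beta> = 1 - \<alpha>" using assms by simp
  fix x assume "x \<in> V \<times> W"
  then show "induced_sum \<alpha> M \<beta> N x x = t - 1"
    using assms by (auto simp: induced_sum_def kronecker_def all_ones_def gram_coloring_def b algebra_simps)
next
  fix x y assume "(x, y) \<in> product_arcs E F"
  then have "M (fst x) (fst y) \<le> -1" "N (snd x) (snd y) \<le> -1"
    using assms by (auto simp: product_arcs_def gram_coloring_def)
  then have "\<alpha> * M (fst x) (fst y) + \<beta> * N (snd x) (snd y) \<le> \<alpha> * (-1) + \<beta> * (-1)"
    using assms by (intro add_mono mult_left_mono) auto
  then show "induced_sum \<alpha> M \<beta> N x y \<le> -1"
    using assms by (simp add: induced_sum_def kronecker_def all_ones_def)
qed

lemma gram_coloring_mean:
  assumes "gram_coloring V E t X" "gram_coloring V E t Y"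
  shows "gram_coloring V E t (\<lambda>i j. 1/2 * X i j + 1/2 * Y i j)"
  unfolding gram_coloring_def
proof (intro conjI ballI allI impI)
  show "psd V (\<lambda>i j. 1/2 * X i j + 1/2 * Y i j)"
    using assms by (intro psd_add psd_scale) (auto simp: gram_coloring_def)
  fix i j assume "(i, j) \<in> E"
  then have "X i j \<le> -1" "Y i j \<le> -1" using assms by (auto simp: gram_coloring_def)
  then show "1/2 * X i j + 1/2 * Y i j \<le> -1" by simp
qed (use assms in \<open>auto simp: gram_coloring_def field_simps\<close>)

text \<open>For \<open>s = 0\<close> the matrix vanishes and cannot be rescaled; the given coloring
  \<open>M\<close> then serves with coefficient 0.\<close>

lemma gram_coloring_rescale:
  assumes fin: "finite V" and t: "1 < t" and M: "gram_coloring V E t M"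
    and A: "psd V A" "\<And>i. i \<in> V \<Longrightarrow> A i i = s" and s: "0 \<le> s"
    and edge: "\<And>i j. (i, j) \<in> E \<Longrightarrow> A i j \<le> - s / (t - 1)"
  shows "\<exists>M'. gram_coloring V E t M' \<and> (\<forall>i\<in>V. \<forall>j\<in>V. A i j = s / (t - 1) * M' i j)"
proof (cases "s = 0")
  case True
  then have "A i j = 0" if "i \<in> V" "j \<in> V" for i j using psd_zero_diag[OF fin A(1)] A(2) that by simp
  then show ?thesis using M True by auto
next
  case False
  with s have s0: "0 < s" by simp
  have "gram_coloring V E t (\<lambda>i j. (t - 1) / s * A i j)"
    unfolding gram_coloring_def
  proof (intro conjI ballI allI impI)
    show "psd V (\<lambda>i j. (t - 1) / s * A i j)" using t s0 by (intro psd_scale A) auto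
    fix i j assume "(i, j) \<in> E"
    then have "(t - 1) / s * A i j \<le> (t - 1) / s * (- s / (t - 1))"
      using t s0 by (intro mult_left_mono edge) auto
    then show "(t - 1) / s * A i j \<le> -1" using t s0 by simp
  qed (use t s0 A(2) in auto)
  then show ?thesis using t s0 by (intro exI[of _ "\<lambda>i j. (t - 1) / s * A i j"]) auto
qed

text \<open>In the application \<open>q\<close> is a fixed entry of the other summand. Weighting the
  edge inequalities by \<open>B\<close> bounds the nonnegative inner product of \<open>B\<close> and
  \<open>A\<close> by \<open>t * (- 1 - q) + (s + 1 + q)\<close>; solving for \<open>q\<close>
  leaves it a proportional share of the -1.\<close>

lemma certificate_edge_average:
  assumes fin: "finite V" and B: "dual_certificate V E t B" and tot: "(\<Sum>i\<in>V. \<Sum>j\<in>V. B i j) = t"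
    and t: "1 < t" and A: "psd V A" "\<And>i. i \<in> V \<Longrightarrow> A i i = s"
    and edge: "\<And>i j. (i, j) \<in> E \<Longrightarrow> A i j + q \<le> -1"
  shows "q \<le> - (t - 1 - s) / (t - 1)"
proof -
  have "B i j * A i j \<le> B i j * (- 1 - q) + (if i = j then (s + 1 + q) * B i i else 0)"
    if "i \<in> V" "j \<in> V" for i j
  proof (cases "i = j")
    case True
    then show ?thesis using A(2)[OF that(1)] by (simp add: algebra_simps)
  next
    case False
    have "B i j * A i j \<le> B i j * (- 1 - q)"
    proof (cases "(i, j) \<in> E")
      case True
      have "A i j \<le> - 1 - q" using edge[OF True] by simp
      then show ?thesis using B that by (intro mult_left_mono) (auto simp: dual_certificate_def)
    next
      case nE: False
      then have "B i j = 0" using B that False by (auto simp: dual_certificate_def)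
      then show ?thesis by simp
    qed
    then show ?thesis using False by simp
  qed
  then have "(\<Sum>i\<in>V. \<Sum>j\<in>V. B i j * A i j) \<le>
      (\<Sum>i\<in>V. \<Sum>j\<in>V. B i j * (- 1 - q) + (if i = j then (s + 1 + q) * B i i else 0))"
    by (intro sum_mono) auto
  also have "\<dots> = (\<Sum>i\<in>V. \<Sum>j\<in>V. B i j) * (- 1 - q) + (s + 1 + q) * (\<Sum>i\<in>V. B i i)"
    unfolding sum.distrib sum_diagonal[OF fin] by (simp add: sum_distrib_right sum_distrib_left)
  also have "\<dots> = t * (- 1 - q) + (s + 1 + q)" using B tot by (simp add: dual_certificate_def)
  finally have "0 \<le> t * (- 1 - q) + (s + 1 + q)"
    using psd_product_nonneg[OF fin _ A(1), of B] B by (simp add: dual_certificate_def)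
  then have "q * (t - 1) \<le> - (t - 1 - s)" by (simp add: algebra_simps)
  then show ?thesis using t by (simp add: pos_le_divide_eq)
qed

text \<open>The Gram factors of \<open>P\<close> are tested on vectors whose marginals lie in the
  two kernels, which splits them additively. The constant diagonal of \<open>P\<close>, averaged
  over one coordinate at a time, then makes the diagonals of both parts constant.\<close>

lemma split_product_coloring:
  assumes fin: "finite V" "finite W" and EF: "E \<subseteq> V \<times> V" "F \<subseteq> W \<times> W" and t: "1 < t"
    and B: "dual_certificate V E t B" "(\<Sum>i\<in>V. \<Sum>j\<in>V. B i j) = t" "null_vector V M (\<lambda>i. B i i)"
    and C: "dual_certificate W F t C" "(\<Sum>i\<in>W. \<Sum>j\<in>W. C i j) = t" "null_vector W N (\<lambda>i. C i i)"
    and P: "gram_coloring (V \<times> W) (product_arcs E F) t P"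
    and null: "\<And>c. null_vector V M (\<lambda>j. \<Sum>k\<in>W. c (j, k)) \<Longrightarrow> null_vector W N (\<lambda>k. \<Sum>j\<in>V. c (j, k)) \<Longrightarrow>
      null_vector (V \<times> W) P c"
  obtains A Q s r where "psd V A" "psd W Q" "\<And>i. i \<in> V \<Longrightarrow> A i i = s" "\<And>l. l \<in> W \<Longrightarrow> Q l l = r"
    "0 \<le> s" "0 \<le> r" "s + r = t - 1"
    "\<And>i j. (i, j) \<in> E \<Longrightarrow> A i j \<le> - s / (t - 1)" "\<And>l k. (l, k) \<in> F \<Longrightarrow> Q l k \<le> - r / (t - 1)"
    "\<And>i j l k. i \<in> V \<Longrightarrow> j \<in> V \<Longrightarrow> l \<in> W \<Longrightarrow> k \<in> W \<Longrightarrow> P (i, l) (j, k) = A i j + Q l k"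
proof -
  define D where "D i = B i i" for i
  define D' where "D' l = C l l" for l
  have D1: "(\<Sum>i\<in>V. D i) = 1" "(\<Sum>l\<in>W. D' l) = 1" and Dn: "null_vector V M D" "null_vector W N D'"
    using B C by (auto simp: D_def[abs_def] D'_def[abs_def] dual_certificate_def)
  have D0: "0 \<le> D i" if "i \<in> V" for i using B that by (auto simp: D_def dual_certificate_def)
  have D0': "0 \<le> D' i" if "i \<in> W" for i using C that by (auto simp: D'_def dual_certificate_def)
  have "psd (V \<times> W) P" using P by (simp add: gram_coloring_def)
  from psd_factor_exists[OF _ this] fin obtain d and u :: "nat \<Rightarrow> 'a \<times> 'b \<Rightarrow> real"
    where u: "\<forall>x\<in>V \<times> W. \<forall>y\<in>V \<times> W. P x y = (\<Sum>m<d. u m x * u m y)" by auto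
  have nullu: "(\<Sum>i\<in>V. \<Sum>l\<in>W. u m (i, l) * c (i, l)) = 0"
    if "null_vector V M (\<lambda>j. \<Sum>k\<in>W. c (j, k))" "null_vector W N (\<lambda>k. \<Sum>j\<in>V. c (j, k))" "m < d" for c m
    using null_vector_factor(1)[where V = "V \<times> W" and X = P and u = u and d = d and f = c] u null[OF that(1,2)] that(3)
    unfolding sum_Times by auto
  define a where "a m i = (\<Sum>l\<in>W. D' l * u m (i, l))" for m i
  define b where "b m l = (\<Sum>i\<in>V. D i * u m (i, l))" for m l
  have uab: "u m (i, l) = a m i + b m l" if il: "i \<in> V" "l \<in> W" and m: "m < d" for m i l
  proof -
    \<comment> \<open>The point mass at \<open>(i, l)\<close>, minus the point mass at
      \<open>i\<close> times \<open>D'\<close>, minus \<open>D\<close> times the point mass at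
      \<open>l\<close>. Its marginals are the negatives of \<open>D\<close> and
      \<open>D'\<close>.\<close>
    define c where "c = (\<lambda>(j, k). (if j = i then (if k = l then 1 else 0) - D' k else 0) - (if k = l then D j else 0))"
    have "(\<Sum>k\<in>W. c (j, k)) = 0 * D j + (-1) * D j" if "j \<in> V" for j
      using il D1 fin that by (cases "j = i") (simp_all add: c_def sum_subtractf sum_negf)
    then have 1: "null_vector V M (\<lambda>j. \<Sum>k\<in>W. c (j, k)) \<longleftrightarrow> null_vector V M (\<lambda>j. 0 * D j + (-1) * D j)"
      by (intro null_vector_cong) auto
    have "(\<Sum>j\<in>V. c (j, k)) = 0 * D' k + (-1) * D' k" if "k \<in> W" for k
      using il D1 fin that by (cases "k = l") (simp_all add: c_def sum_subtractf sum_negf)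
    then have 2: "null_vector W N (\<lambda>k. \<Sum>j\<in>V. c (j, k)) \<longleftrightarrow> null_vector W N (\<lambda>k. 0 * D' k + (-1) * D' k)"
      by (intro null_vector_cong) auto
    have "(\<Sum>j\<in>V. \<Sum>k\<in>W. u m (j, k) * c (j, k)) = 0"
      using 1 2 null_vector_lincomb[OF Dn(1) Dn(1)] null_vector_lincomb[OF Dn(2) Dn(2)] m
      by (intro nullu) blast+
    moreover have "(\<Sum>k\<in>W. u m (j, k) * c (j, k)) = (if j = i then u m (i, l) - a m i else 0) - D j * u m (j, l)"
      if "j \<in> V" for j
    proof -
      have "(\<Sum>k\<in>W. u m (j, k) * c (j, k)) =
          (\<Sum>k\<in>W. (if k = l then (if j = i then u m (i, l) else 0) - D j * u m (j, l) else 0)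
            - (if j = i then D' k * u m (i, k) else 0))"
        by (intro sum.cong) (auto simp: c_def algebra_simps)
      then show ?thesis using il fin by (simp add: sum_subtractf a_def)
    qed
    ultimately have "(\<Sum>j\<in>V. (if j = i then u m (i, l) - a m i else 0) - D j * u m (j, l)) = 0" by simp
    then show ?thesis using il fin by (simp add: sum_subtractf b_def)
  qed
  have Da: "(\<Sum>i\<in>V. D i * a m i) = 0" if m: "m < d" for m
  proof -
    \<comment> \<open>The product of the weights has marginals \<open>D\<close> and
      \<open>D'\<close>, so the weighted mean of \<open>u m\<close> is 0.\<close>
    have "(\<Sum>i\<in>V. \<Sum>l\<in>W. u m (i, l) * (\<lambda>x. D (fst x) * D' (snd x)) (i, l)) = 0"
      using D1 Dn m by (intro nullu) (simp_all add: sum_distrib_left[symmetric] sum_distrib_right[symmetric])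
    then show ?thesis by (simp add: a_def sum_distrib_left mult_ac)
  qed
  have "(\<Sum>l\<in>W. D' l * b m l) = (\<Sum>i\<in>V. D i * a m i)" for m
    unfolding a_def b_def sum_distrib_left by (subst sum.swap) (simp add: mult_ac)
  then have Db: "(\<Sum>l\<in>W. D' l * b m l) = 0" if "m < d" for m using Da that by simp
  define A where "A i j = (\<Sum>m<d. a m i * a m j)" for i j
  define Q where "Q l k = (\<Sum>m<d. b m l * b m k)" for l k
  define K where "K i k = (\<Sum>m<d. a m i * b m k)" for i k
  have PAQ: "P (i, l) (j, k) = A i j + K i k + K j l + Q l k"
    if "i \<in> V" "j \<in> V" "l \<in> W" "k \<in> W" for i j l k
  proof -
    have "P (i, l) (j, k) = (\<Sum>m<d. (a m i + b m l) * (a m j + b m k))"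
      using u that uab by simp
    then show ?thesis by (simp add: A_def Q_def K_def algebra_simps sum.distrib)
  qed
  have DK: "(\<Sum>i\<in>V. D i * K i k) = 0" for k
  proof -
    have "(\<Sum>i\<in>V. D i * K i k) = (\<Sum>m<d. (\<Sum>i\<in>V. D i * a m i) * b m k)"
      unfolding K_def sum_distrib_left sum_distrib_right by (subst sum.swap) (simp add: mult_ac)
    then show ?thesis using Da by simp
  qed
  have DK': "(\<Sum>l\<in>W. D' l * K i l) = 0" for i
  proof -
    have "(\<Sum>l\<in>W. D' l * K i l) = (\<Sum>m<d. a m i * (\<Sum>l\<in>W. D' l * b m l))"
      unfolding K_def sum_distrib_left by (subst sum.swap) (simp add: mult_ac)
    then show ?thesis using Db by simp
  qed
  define s where "s = (\<Sum>i\<in>V. D i * A i i)"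
  define r where "r = (\<Sum>l\<in>W. D' l * Q l l)"
  have diag: "A i i + 2 * K i l + Q l l = t - 1" if "i \<in> V" "l \<in> W" for i l
    using PAQ[of i i l l] P that by (simp add: gram_coloring_def)
  have Ql: "s + Q l l = t - 1" if l: "l \<in> W" for l
  proof -
    have "(\<Sum>i\<in>V. D i * (A i i + 2 * K i l + Q l l)) = (\<Sum>i\<in>V. D i * (t - 1))"
      using diag l by (intro sum.cong) auto
    moreover have "(\<Sum>i\<in>V. D i * (A i i + 2 * K i l + Q l l)) = s + 2 * (\<Sum>i\<in>V. D i * K i l) + (\<Sum>i\<in>V. D i) * Q l l"
      by (simp add: s_def algebra_simps sum.distrib sum_distrib_left sum_distrib_right)
    ultimately show ?thesis using DK D1 by (simp add: sum_distrib_right[symmetric])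
  qed
  have Ai: "A i i + r = t - 1" if i: "i \<in> V" for i
  proof -
    have "(\<Sum>l\<in>W. D' l * (A i i + 2 * K i l + Q l l)) = (\<Sum>l\<in>W. D' l * (t - 1))"
      using diag i by (intro sum.cong) auto
    moreover have "(\<Sum>l\<in>W. D' l * (A i i + 2 * K i l + Q l l)) = (\<Sum>l\<in>W. D' l) * A i i + 2 * (\<Sum>l\<in>W. D' l * K i l) + r"
      by (simp add: r_def algebra_simps sum.distrib sum_distrib_left sum_distrib_right)
    ultimately show ?thesis using DK' D1 by (simp add: sum_distrib_right[symmetric])
  qed
  \<comment> \<open>The cross terms are constant, and by \<open>DK\<close> their weighted mean is 0;
    hence they vanish and \<open>s + r = t - 1\<close>.\<close>
  have Kc: "2 * K i l = s + r - (t - 1)" if "i \<in> V" "l \<in> W" for i l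
    using diag[OF that] Ql[OF that(2)] Ai[OF that(1)] by linarith
  have "W \<noteq> {}" using D1 by auto
  then obtain l0 where l0: "l0 \<in> W" by auto
  have "(\<Sum>i\<in>V. D i * (2 * K i l0)) = (\<Sum>i\<in>V. D i * (s + r - (t - 1)))"
    using Kc l0 by (intro sum.cong) auto
  moreover have "(\<Sum>i\<in>V. D i * (2 * K i l0)) = 2 * (\<Sum>i\<in>V. D i * K i l0)"
    by (simp add: sum_distrib_left mult_ac)
  ultimately have sr: "s + r = t - 1" using DK D1 by (simp add: sum_distrib_right[symmetric])
  then have K0: "K i l = 0" if "i \<in> V" "l \<in> W" for i l using Kc[OF that] by simp
  have PAQ0: "P (i, l) (j, k) = A i j + Q l k" if "i \<in> V" "j \<in> V" "l \<in> W" "k \<in> W" for i j l k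
    using PAQ[OF that] K0 that by simp
  have pA: "psd V A" by (rule psd_factor[of V A "\<lambda>m i. a m i"]) (simp add: A_def)
  have pQ: "psd W Q" by (rule psd_factor[of W Q "\<lambda>m i. b m i"]) (simp add: Q_def)
  have As: "A i i = s" if "i \<in> V" for i using Ai[OF that] sr by simp
  have Qr: "Q l l = r" if "l \<in> W" for l using Ql[OF that] sr by simp
  have s0: "0 \<le> s" unfolding s_def by (intro sum_nonneg mult_nonneg_nonneg D0 psd_diag_nonneg[OF pA fin(1)])
  have r0: "0 \<le> r" unfolding r_def by (intro sum_nonneg mult_nonneg_nonneg D0' psd_diag_nonneg[OF pQ fin(2)])
  have PE: "A i j + Q l k \<le> -1" if "(i, j) \<in> E" "(l, k) \<in> F" for i j l k
  proof -
    have "((i, l), (j, k)) \<in> product_arcs E F" using that by (simp add: product_arcs_def)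
    then have "P (i, l) (j, k) \<le> -1" using P by (simp add: gram_coloring_def)
    moreover have "i \<in> V" "j \<in> V" "l \<in> W" "k \<in> W" using that EF by auto
    ultimately show ?thesis using PAQ0[of i j l k] by simp
  qed
  have AE: "A i j \<le> - s / (t - 1)" if ij: "(i, j) \<in> E" for i j
  proof -
    \<comment> \<open>The entry at the fixed edge plays the part of \<open>q\<close>, while the
      edges of the other factor are averaged with its certificate \<open>C\<close>.\<close>
    have "A i j \<le> - (t - 1 - r) / (t - 1)"
      using PE[OF ij] by (intro certificate_edge_average[OF fin(2) C(1,2) t pQ Qr]) (auto simp: add.commute)
    then show ?thesis by (simp add: sr[symmetric])
  qed
  have QF: "Q l k \<le> - r / (t - 1)" if lk: "(l, k) \<in> F" for l k
  proof -
    have "Q l k \<le> - (t - 1 - s) / (t - 1)"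
      using PE[OF _ lk] by (intro certificate_edge_average[OF fin(1) B(1,2) t pA As]) auto
    then show ?thesis by (simp add: sr[symmetric])
  qed
  show ?thesis by (rule that[OF pA pQ As Qr s0 r0 sr AE QF PAQ0])
qed

section \<open>Graphs\<close>

lemma pair_graph_simps:
  assumes "pair_graph G"
  shows "finite (pverts G)" "parcs G \<subseteq> pverts G \<times> pverts G" "(i, i) \<notin> parcs G"
    "(i, j) \<in> parcs G \<Longrightarrow> (j, i) \<in> parcs G"
proof -
  interpret pair_graph G by fact
  show "finite (pverts G)" by (rule pair_finite_verts)
  show "parcs G \<subseteq> pverts G \<times> pverts G" using in_arcsD1 in_arcsD2 by auto
  show "(i, i) \<notin> parcs G" using no_loops' by blast
  show "(i, j) \<in> parcs G \<Longrightarrow> (j, i) \<in> parcs G" using arcs_symmetric by blast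
qed

lemma categorical_product_simps:
  "pverts (categorical_product G H) = pverts G \<times> pverts H"
  "parcs (categorical_product G H) = product_arcs (parcs G) (parcs H)"
  by (auto simp: categorical_product_def product_arcs_def)

lemma pair_graph_categorical_product:
  assumes "pair_graph G" "pair_graph H"
  shows "pair_graph (categorical_product G H)"
proof -
  note G = pair_graph_simps[OF assms(1)] and H = pair_graph_simps[OF assms(2)]
  have sub: "product_arcs (parcs G) (parcs H) \<subseteq> (pverts G \<times> pverts H) \<times> (pverts G \<times> pverts H)"
    using G(2) H(2) by (auto simp: product_arcs_def)
  show ?thesis
  proof
    fix e assume "e \<in> parcs (categorical_product G H)"
    then obtain i l j k where "e = ((i, l), (j, k))" "(i, j) \<in> parcs G" "(l, k) \<in> parcs H"
      by (auto simp: categorical_product_simps product_arcs_def)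
    then show "fst e \<in> pverts (categorical_product G H)" "snd e \<in> pverts (categorical_product G H)"
      "fst e \<noteq> snd e"
      using G(2,3) H(2) by (auto simp: categorical_product_simps)
  next
    show "finite (pverts (categorical_product G H))" using G H by (simp add: categorical_product_simps)
    show "finite (parcs (categorical_product G H))"
      unfolding categorical_product_simps by (rule finite_subset[OF sub]) (use G H in auto)
    show "symmetric (with_proj (categorical_product G H))"
      using G(4) H(4) by (auto simp: symmetric_def sym_def categorical_product_simps product_arcs_def)
  qed
qed

section \<open>Vector colorings and their Gram matrices\<close>

abbreviation graph_gram_coloring :: "'a pair_pre_digraph \<Rightarrow> real \<Rightarrow> ('a \<Rightarrow> 'a \<Rightarrow> real) \<Rightarrow> bool" where
  "graph_gram_coloring G \<equiv> gram_coloring (pverts G) (parcs G)"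

lemma vector_coloring_imp_gram_coloring:
  assumes "vector_coloring G t d p"
  shows "graph_gram_coloring G t (gram p)"
proof -
  have "psd (pverts G) (gram p)"
    by (rule psd_factor[of _ _ "\<lambda>m i. p i $ m" d]) (use assms in \<open>auto simp: vector_coloring_def intro: gram_coords\<close>)
  then show ?thesis using assms by (simp add: vector_coloring_def gram_coloring_def gram_def)
qed

text \<open>The ambient dimension of a coloring is arbitrary, so any factorisation of
  \<open>X\<close> supplies the vectors.\<close>

lemma gram_coloring_imp_vector_coloring:
  assumes "pair_graph G" "graph_gram_coloring G t X"
  shows "\<exists>d p. vector_coloring G t d p \<and> (\<forall>i\<in>pverts G. \<forall>j\<in>pverts G. gram p i j = X i j)"
proof -
  note G = pair_graph_simps[OF assms(1)]
  have "psd (pverts G) X" using assms(2) by (simp add: gram_coloring_def)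
  from psd_factor_exists[OF G(1) this] obtain d and u :: "nat \<Rightarrow> 'a \<Rightarrow> real"
    where u: "\<forall>i\<in>pverts G. \<forall>j\<in>pverts G. X i j = (\<Sum>m<d. u m i * u m j)" by blast
  define p where "p i = vec d (\<lambda>m. u m i)" for i
  have gr: "gram p i j = X i j" if "i \<in> pverts G" "j \<in> pverts G" for i j
    using u that by (simp add: gram_def p_def scalar_prod_def atLeast0LessThan)
  have "vector_coloring G t d p"
    unfolding vector_coloring_def
  proof (intro conjI ballI allI impI)
    fix i assume "i \<in> pverts G"
    then show "p i \<bullet> p i = t - 1" using gr[of i i] assms(2) by (simp add: gram_def gram_coloring_def)
    show "p i \<in> carrier_vec d" by (simp add: p_def)
  next
    fix i j assume ij: "(i, j) \<in> parcs G"
    then have "gram p i j = X i j" using G(2) by (intro gr) auto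
    then show "p i \<bullet> p j \<le> -1" using ij assms(2) by (simp add: gram_def gram_coloring_def)
  qed (use assms(2) in \<open>simp add: gram_coloring_def\<close>)
  then show ?thesis using gr by blast
qed

lemma vector_chromatic_number_eqI:
  assumes "pair_graph G" "graph_gram_coloring G t X" "\<And>s Y. graph_gram_coloring G s Y \<Longrightarrow> t \<le> s"
  shows "vector_chromatic_number G = t"
  unfolding vector_chromatic_number_def
proof (rule Least_equality)
  show "\<exists>d p. vector_coloring G t d p" using gram_coloring_imp_vector_coloring[OF assms(1,2)] by blast
qed (use vector_coloring_imp_gram_coloring assms(3) in blast)

lemma vector_chromatic_number_attained:
  assumes "pair_graph G"
  obtains X where "graph_gram_coloring G (vector_chromatic_number G) X"
    "\<And>s Y. graph_gram_coloring G s Y \<Longrightarrow> vector_chromatic_number G \<le> s"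
proof -
  note G = pair_graph_simps[OF assms]
  obtain t X where t: "graph_gram_coloring G t X" "\<And>s Y. graph_gram_coloring G s Y \<Longrightarrow> t \<le> s"
    using minimal_gram_coloring_exists[OF G(1,2,3)] by blast
  then have "vector_chromatic_number G = t" by (rule vector_chromatic_number_eqI[OF assms])
  with t that show ?thesis by blast
qed

lemma coloring_rank_eq:
  assumes "pair_graph G" "optimal_vector_coloring G d p"
  shows "coloring_rank G d p = psd_rank (pverts G) (gram p)"
  unfolding coloring_rank_def using assms pair_graph_simps(1)
  by (intro span_dim_eq_psd_rank) (auto simp: optimal_vector_coloring_def vector_coloring_def)

text \<open>Ranks depend on the Gram matrix alone and are at most the number of vertices, so
  \<open>max_rank\<close> is the maximum of a finite nonempty set.\<close>

lemma max_rank_bounds: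
  assumes G: "pair_graph G"
  shows "graph_gram_coloring G (vector_chromatic_number G) X \<Longrightarrow> psd_rank (pverts G) X \<le> max_rank G"
    and "\<exists>d p. optimal_vector_coloring G d p \<and> psd_rank (pverts G) (gram p) = max_rank G"
proof -
  let ?R = "{coloring_rank G d p | d p. optimal_vector_coloring G d p}"
  have "?R \<subseteq> {..card (pverts G)}"
    using coloring_rank_eq[OF G] psd_rank_le_card[OF pair_graph_simps(1)[OF G]] by auto
  then have fin: "finite ?R" by (rule finite_subset) simp
  have real: "\<exists>d p. optimal_vector_coloring G d p \<and> coloring_rank G d p = psd_rank (pverts G) X"
    if X: "graph_gram_coloring G (vector_chromatic_number G) X" for X
  proof -
    obtain d p where p: "vector_coloring G (vector_chromatic_number G) d p"
      "\<forall>i\<in>pverts G. \<forall>j\<in>pverts G. gram p i j = X i j"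
      using gram_coloring_imp_vector_coloring[OF G X] by blast
    then have o: "optimal_vector_coloring G d p" by (simp add: optimal_vector_coloring_def)
    have "psd_rank (pverts G) (gram p) = psd_rank (pverts G) X" using p(2) by (intro psd_rank_cong) auto
    then show ?thesis using o coloring_rank_eq[OF G o] by auto
  qed
  show "psd_rank (pverts G) X \<le> max_rank G" if "graph_gram_coloring G (vector_chromatic_number G) X"
  proof -
    have "psd_rank (pverts G) X \<in> ?R" using real[OF that] by force
    then show ?thesis unfolding max_rank_def using fin by (rule Max_ge[rotated])
  qed
  obtain X where "graph_gram_coloring G (vector_chromatic_number G) X"
    using vector_chromatic_number_attained[OF G] by blast
  then have "?R \<noteq> {}" using real by blast
  then have "max_rank G \<in> ?R" unfolding max_rank_def using fin by (intro Max_in)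
  then show "\<exists>d p. optimal_vector_coloring G d p \<and> psd_rank (pverts G) (gram p) = max_rank G"
    using coloring_rank_eq[OF G] by force
qed

lemma optimal_imp_gram_coloring:
  "optimal_vector_coloring G d p \<Longrightarrow> graph_gram_coloring G (vector_chromatic_number G) (gram p)"
  by (auto simp: optimal_vector_coloring_def intro: vector_coloring_imp_gram_coloring)

section \<open>Zero Gram matrices and the degenerate value t = 1\<close>

lemma gram_coloring_one_zero:
  assumes "finite V" "gram_coloring V E 1 X" "i \<in> V" "j \<in> V"
  shows "X i j = 0"
  using assms by (simp add: gram_coloring_def psd_zero_diag)

lemma psd_rank_zero:
  assumes "finite V" "\<And>i j. i \<in> V \<Longrightarrow> j \<in> V \<Longrightarrow> X i j = 0"
  shows "psd_rank V X = 0"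
proof -
  obtain S where S: "null_free V X S" "card S = psd_rank V X" using psd_rank_attained[OF assms(1)] .
  define f where "f i = (if i \<in> S then 1 else 0 :: real)" for i
  have "null_vector V X f" using assms(2) by (simp add: null_vector_def)
  moreover have "f i = 0" if "i \<in> V - S" for i using that by (simp add: f_def)
  ultimately have "f i = 0" if "i \<in> V" for i using null_freeD[OF S(1)] that by blast
  moreover have "S \<subseteq> V" using S(1) by (simp add: null_free_def)
  ultimately have "S = {}" by (metis f_def one_neq_zero subset_empty subset_iff)
  then show ?thesis using S by simp
qed

lemma psd_rank_pos:
  assumes "finite V" "i \<in> V" "X i i \<noteq> 0"
  shows "0 < psd_rank V X"
proof -
  have "null_free V X {i}"
    unfolding null_free_def
  proof (intro conjI allI impI ballI)
    fix f j assume f: "null_vector V X f" "\<forall>k\<in>V - {i}. f k = 0" "j \<in> {i}"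
    have "(\<Sum>k\<in>V. X i k * f k) = X i i * f i"
      using f(2) assms by (subst sum.remove[of V i]) auto
    then show "f j = 0" using f assms by (simp add: null_vector_def)
  qed (use assms in simp)
  from null_free_card_le[OF assms(1) this] show ?thesis by simp
qed

lemma max_rank_eq_zero:
  assumes "pair_graph G" "vector_chromatic_number G = 1"
  shows "max_rank G = 0"
proof -
  obtain d p where p: "optimal_vector_coloring G d p" "psd_rank (pverts G) (gram p) = max_rank G"
    using max_rank_bounds(2)[OF assms(1)] by blast
  have "gram_coloring (pverts G) (parcs G) 1 (gram p)" using optimal_imp_gram_coloring[OF p(1)] assms(2) by simp
  from gram_coloring_one_zero[OF pair_graph_simps(1)[OF assms(1)] this] show ?thesis
    using p(2) psd_rank_zero[OF pair_graph_simps(1)[OF assms(1)], of "gram p"] by simp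
qed

text \<open>Vectors of length 0 violate every edge inequality, so there are no arcs and all optimal
  Gram matrices vanish on the vertices.\<close>

lemma chromatic_one_case:
  assumes G: "pair_graph G" and H: "pair_graph H"
    and one: "vector_chromatic_number G = 1" "vector_chromatic_number H = 1"
  shows "vector_chromatic_number (categorical_product G H) = 1"
    and "optimal_vector_coloring (categorical_product G H) d p \<Longrightarrow> convex_combination_of_induced G H p"
proof -
  have GH: "pair_graph (categorical_product G H)" by (rule pair_graph_categorical_product[OF G H])
  obtain e q where q: "optimal_vector_coloring G e q" using max_rank_bounds(2)[OF G] by blast
  obtain f r where r: "optimal_vector_coloring H f r" using max_rank_bounds(2)[OF H] by blast
  have qX: "graph_gram_coloring G 1 (gram q)" using optimal_imp_gram_coloring[OF q] one by simp
  have q0: "gram q i j = 0" if "i \<in> pverts G" "j \<in> pverts G" for i j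
    by (rule gram_coloring_one_zero[OF pair_graph_simps(1)[OF G] qX that])
  have "parcs G = {}"
  proof (rule ccontr)
    assume "parcs G \<noteq> {}"
    then obtain i j where ij: "(i, j) \<in> parcs G" by fast
    then have "gram q i j \<le> -1" using qX by (simp add: gram_coloring_def)
    moreover have "gram q i j = 0" using ij pair_graph_simps(2)[OF G] by (intro q0) auto
    ultimately show False by simp
  qed
  then have "graph_gram_coloring (categorical_product G H) 1 (\<lambda>_ _. 0)"
    by (auto simp: gram_coloring_def psd_def quad_form_def categorical_product_simps product_arcs_def)
  then show GH1: "vector_chromatic_number (categorical_product G H) = 1"
    by (rule vector_chromatic_number_eqI[OF GH]) (simp add: gram_coloring_def)
  assume p: "optimal_vector_coloring (categorical_product G H) d p"
  have "graph_gram_coloring (categorical_product G H) 1 (gram p)"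
    using optimal_imp_gram_coloring[OF p] GH1 by simp
  then have "gram p x y = 0" if "x \<in> pverts G \<times> pverts H" "y \<in> pverts G \<times> pverts H" for x y
    using gram_coloring_one_zero[OF pair_graph_simps(1)[OF GH]] that by (simp add: categorical_product_simps)
  then have "\<forall>x\<in>pverts (categorical_product G H). \<forall>y\<in>pverts (categorical_product G H).
      gram p x y = 1 * kronecker (gram q) all_ones x y + 0 * kronecker all_ones (gram r) x y"
    using q0 by (auto simp: categorical_product_simps kronecker_def)
  with q r show "convex_combination_of_induced G H p"
    unfolding convex_combination_of_induced_def
    by (intro exI[of _ e] exI[of _ q] exI[of _ f] exI[of _ r] exI[of _ 1] exI[of _ 0]) simp
qed

lemma optimal_vector_coloring_of_gram:
  assumes "pair_graph G" "graph_gram_coloring G (vector_chromatic_number G) X"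
  obtains d p where "optimal_vector_coloring G d p" "\<And>i j. i \<in> pverts G \<Longrightarrow> j \<in> pverts G \<Longrightarrow> gram p i j = X i j"
  using gram_coloring_imp_vector_coloring[OF assms] by (auto simp: optimal_vector_coloring_def)

section \<open>Additivity of the maximum rank and the form of optimal colorings\<close>

theorem mainTheorem3:
  fixes G :: "'a pair_pre_digraph" and H :: "'b pair_pre_digraph"
  assumes "pair_graph G" and "pair_graph H"
    and "vector_chromatic_number G = vector_chromatic_number H"
  shows "max_rank (categorical_product G H) = max_rank G + max_rank H \<longleftrightarrow>
    (\<forall>d p. optimal_vector_coloring (categorical_product G H) d p \<longrightarrow>
           convex_combination_of_induced G H p)"
proof (cases "vector_chromatic_number G = 1")
  \<comment> \<open>Both sides hold: all three ranks are 0, and every optimal Gram matrix of the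
    product is 0.\<close>
  case True
  then have H: "vector_chromatic_number H = 1" using assms(3) by simp
  note one = chromatic_one_case[OF assms(1,2) True H]
  show ?thesis
    using one(2) max_rank_eq_zero[OF assms(1) True] max_rank_eq_zero[OF assms(2) H]
      max_rank_eq_zero[OF pair_graph_categorical_product[OF assms(1,2)] one(1)] by simp
next
  case False
  define t where "t = vector_chromatic_number G"
  let ?GH = "categorical_product G H" and ?V = "pverts G" and ?W = "pverts H"
  have tH: "vector_chromatic_number H = t" using assms(3) by (simp add: t_def)
  have GH: "pair_graph ?GH" by (rule pair_graph_categorical_product[OF assms(1,2)])
  note G = pair_graph_simps[OF assms(1)] and H = pair_graph_simps[OF assms(2)]
  obtain q0 where q0: "graph_gram_coloring G t q0" "\<And>s Y. graph_gram_coloring G s Y \<Longrightarrow> t \<le> s"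
    using vector_chromatic_number_attained[OF assms(1)] unfolding t_def by blast
  have minH: "\<And>s Y. graph_gram_coloring H s Y \<Longrightarrow> t \<le> s"
    using vector_chromatic_number_attained[OF assms(2)] unfolding tH by blast
  have t: "1 < t" using q0(1) False by (simp add: gram_coloring_def t_def)
  obtain d1 q where q: "optimal_vector_coloring G d1 q" "psd_rank ?V (gram q) = max_rank G"
    using max_rank_bounds(2)[OF assms(1)] by blast
  obtain d2 r where r: "optimal_vector_coloring H d2 r" "psd_rank ?W (gram r) = max_rank H"
    using max_rank_bounds(2)[OF assms(2)] by blast
  have M: "graph_gram_coloring G t (gram q)" and N: "graph_gram_coloring H t (gram r)"
    using optimal_imp_gram_coloring[OF q(1)] optimal_imp_gram_coloring[OF r(1)] tH t_def by auto
  have "\<exists>B. dual_certificate ?V (parcs G) t B"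
    by (rule strong_duality[OF G(1,2)]) (erule G(4) q0(2) | rule G(3) t)+
  then obtain B where B: "dual_certificate ?V (parcs G) t B" by blast
  have "\<exists>C. dual_certificate ?W (parcs H) t C"
    by (rule strong_duality[OF H(1,2)]) (erule H(4) minH | rule H(3) t)+
  then obtain C where C: "dual_certificate ?W (parcs H) t C" by blast
  note slackB = complementary_slackness[OF G(1) B M] and slackC = complementary_slackness[OF H(1) C N]
  obtain P where P: "dual_certificate (?V \<times> ?W) (product_arcs (parcs G) (parcs H)) t P"
    using product_certificate[OF G(1) H(1) t B slackB(1) C slackC(1)] by blast
  have minGH: "t \<le> s" if "graph_gram_coloring ?GH s Y" for s Y
    using weak_duality(1)[OF _ P that[unfolded categorical_product_simps]] G(1) H(1) by simp
  have ind: "graph_gram_coloring ?GH t (induced_sum (1/2) (gram q) (1/2) (gram r))"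
    unfolding categorical_product_simps
    using M N by (intro gram_coloring_induced_sum G(1) H(1)) auto
  then have tGH: "vector_chromatic_number ?GH = t"
    by (rule vector_chromatic_number_eqI[OF GH _ minGH])
  have psdM: "psd ?V (gram q)" and psdN: "psd ?W (gram r)" using M N by (auto simp: gram_coloring_def)
  have trB: "(\<Sum>i\<in>?V. B i i) = 1" and trC: "(\<Sum>i\<in>?W. C i i) = 1"
    using B C by (auto simp: dual_certificate_def)
  then obtain l where l: "l \<in> ?W" by fastforce
  have "0 < psd_rank ?W (gram r)"
    using N t l by (intro psd_rank_pos[OF H(1) l]) (simp add: gram_coloring_def)
  then have ge: "max_rank G + max_rank H \<le> psd_rank (?V \<times> ?W) (induced_sum (1/2) (gram q) (1/2) (gram r))"
    unfolding q(2)[symmetric] r(2)[symmetric] using slackB(2) trB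
    by (intro psd_rank_induced_sum_ge[OF G(1) H(1) psdM psdN]) auto
  show ?thesis
  proof (intro iffI allI impI)
    assume conv: "\<forall>d p. optimal_vector_coloring ?GH d p \<longrightarrow> convex_combination_of_induced G H p"
    obtain d p where p: "optimal_vector_coloring ?GH d p" "psd_rank (?V \<times> ?W) (gram p) = max_rank ?GH"
      using max_rank_bounds(2)[OF GH] unfolding categorical_product_simps by blast
    obtain e1 q' e2 r' \<alpha> \<beta> where qr: "optimal_vector_coloring G e1 q'" "optimal_vector_coloring H e2 r'"
      and eq: "\<forall>x\<in>?V \<times> ?W. \<forall>y\<in>?V \<times> ?W. gram p x y = induced_sum \<alpha> (gram q') \<beta> (gram r') x y"
      using conv p(1) unfolding convex_combination_of_induced_def categorical_product_simps induced_sum_def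
      by blast
    have "max_rank ?GH = psd_rank (?V \<times> ?W) (induced_sum \<alpha> (gram q') \<beta> (gram r'))"
      unfolding p(2)[symmetric] using eq by (intro psd_rank_cong) auto
    also have "\<dots> \<le> psd_rank ?V (gram q') + psd_rank ?W (gram r')"
      by (rule psd_rank_induced_sum_le[OF G(1) H(1)])
    also have "\<dots> \<le> max_rank G + max_rank H"
      using qr by (intro add_mono max_rank_bounds(1) optimal_imp_gram_coloring assms)
    finally have "max_rank ?GH \<le> max_rank G + max_rank H" .
    moreover have "psd_rank (?V \<times> ?W) (induced_sum (1/2) (gram q) (1/2) (gram r)) \<le> max_rank ?GH"
      using max_rank_bounds(1)[OF GH, unfolded tGH, OF ind] unfolding categorical_product_simps .
    ultimately show "max_rank ?GH = max_rank G + max_rank H" using ge by simp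
  next
    fix d p
    assume rk: "max_rank ?GH = max_rank G + max_rank H" and p: "optimal_vector_coloring ?GH d p"
    let ?X = "induced_sum (1/2) (gram q) (1/2) (gram r)"
    have P: "graph_gram_coloring ?GH t (gram p)" using optimal_imp_gram_coloring[OF p] tGH by simp
    \<comment> \<open>The mean of two optimal Gram matrices is optimal, so its rank is at most
      \<open>max_rank ?GH\<close>, which \<open>rk\<close> and \<open>ge\<close> bound by the rank
      of \<open>?X\<close>. This is the situation of \<open>null_vector_mono\<close>.\<close>
    have "psd_rank (?V \<times> ?W) (\<lambda>x y. 1/2 * ?X x y + 1/2 * gram p x y) \<le> max_rank ?GH"
      using max_rank_bounds(1)[OF GH, unfolded tGH, OF gram_coloring_mean[OF ind P]]
      unfolding categorical_product_simps .
    then have le: "psd_rank (?V \<times> ?W) (\<lambda>x y. 1/2 * ?X x y + 1/2 * gram p x y) \<le> psd_rank (?V \<times> ?W) ?X"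
      using rk ge by simp
    have fin: "finite (?V \<times> ?W)" using G(1) H(1) by simp
    have pX: "psd (?V \<times> ?W) ?X" and pP: "psd (?V \<times> ?W) (gram p)"
      using ind P by (auto simp: gram_coloring_def categorical_product_simps)
    have null: "null_vector (?V \<times> ?W) (gram p) c"
      if "null_vector ?V (gram q) (\<lambda>j. \<Sum>k\<in>?W. c (j, k))" "null_vector ?W (gram r) (\<lambda>k. \<Sum>j\<in>?V. c (j, k))" for c
      by (rule null_vector_mono[OF fin pX pP _ _ le null_vector_induced_sum[OF that]]) auto
    have totB: "(\<Sum>i\<in>?V. \<Sum>j\<in>?V. B i j) = t" using slackB(1) trB by (simp add: sum_distrib_left[symmetric])
    have totC: "(\<Sum>i\<in>?W. \<Sum>j\<in>?W. C i j) = t" using slackC(1) trC by (simp add: sum_distrib_left[symmetric])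
    obtain A Q s u where AQ: "psd ?V A" "psd ?W Q" "\<And>i. i \<in> ?V \<Longrightarrow> A i i = s" "\<And>l. l \<in> ?W \<Longrightarrow> Q l l = u"
      "0 \<le> s" "0 \<le> u" "s + u = t - 1"
      "\<And>i j. (i, j) \<in> parcs G \<Longrightarrow> A i j \<le> - s / (t - 1)" "\<And>l k. (l, k) \<in> parcs H \<Longrightarrow> Q l k \<le> - u / (t - 1)"
      "\<And>i j l k. i \<in> ?V \<Longrightarrow> j \<in> ?V \<Longrightarrow> l \<in> ?W \<Longrightarrow> k \<in> ?W \<Longrightarrow> gram p (i, l) (j, k) = A i j + Q l k"
      by (rule split_product_coloring[OF G(1) H(1) G(2) H(2) t B totB slackB(2) C totC slackC(2)
            P[unfolded categorical_product_simps] null]) auto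
    obtain M' where M': "graph_gram_coloring G t M'" "\<forall>i\<in>?V. \<forall>j\<in>?V. A i j = s / (t - 1) * M' i j"
      using gram_coloring_rescale[OF G(1) t M AQ(1,3,5,8)] by blast
    obtain N' where N': "graph_gram_coloring H t N'" "\<forall>i\<in>?W. \<forall>j\<in>?W. Q i j = u / (t - 1) * N' i j"
      using gram_coloring_rescale[OF H(1) t N AQ(2,4,6,9)] by blast
    obtain e1 q' where q': "optimal_vector_coloring G e1 q'"
      "\<And>i j. i \<in> ?V \<Longrightarrow> j \<in> ?V \<Longrightarrow> gram q' i j = M' i j"
      using optimal_vector_coloring_of_gram[OF assms(1)] M'(1) t_def by metis
    obtain e2 r' where r': "optimal_vector_coloring H e2 r'"
      "\<And>i j. i \<in> ?W \<Longrightarrow> j \<in> ?W \<Longrightarrow> gram r' i j = N' i j"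
      using optimal_vector_coloring_of_gram[OF assms(2)] N'(1) tH by metis
    \<comment> \<open>The coefficients are the shares of the common diagonal \<open>t - 1\<close>
      carried by the two parts.\<close>
    have "s / (t - 1) + u / (t - 1) = 1"
      using AQ(7) t by (simp add: add_divide_distrib[symmetric])
    moreover have "0 \<le> s / (t - 1)" "0 \<le> u / (t - 1)" using AQ(5,6) t by auto
    moreover have "\<forall>x\<in>pverts ?GH. \<forall>y\<in>pverts ?GH. gram p x y =
        s / (t - 1) * kronecker (gram q') all_ones x y + u / (t - 1) * kronecker all_ones (gram r') x y"
      using AQ(10) M'(2) N'(2) q'(2) r'(2)
      by (auto simp: categorical_product_simps kronecker_def all_ones_def)
    ultimately show "convex_combination_of_induced G H p"
      unfolding convex_combination_of_induced_def using q'(1) r'(1) by blast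
  qed
qed

end
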